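(* For $n\ge 3$, $\gamma_{\mathbb G_n}(0;e_{n-1})<A_{\mathbb G_n}(0;e_{n-1})$, and consequently $c^*_{\mathbb G_n}(0,te_{n-1})<\exp g_{\mathbb G_n}(0,te_{n-1})$ for all $t\in\mathbb C$ with $0<|t|$ small enough.
   Context: $\mathbb G_n=\{(s_1(\lambda),\dots,s_n(\lambda)):\lambda\in\mathbb D^n\}\subset\mathbb C^n$, where $s_j$ is the $j$-th elementary symmetric function and $\mathbb D$ the unit disk (the symmetrized polydisk); $e_{n-1}$ is the $(n-1)$-th standard basis vector of $\mathbb C^n$. For a domain $D\subset\mathbb C^n$: the Green function $g_D(z,w)=\sup\{u(w): u$ negative plurisubharmonic on $D$, $u(\xi)\le\log\|\xi-z\|+O(1)$ as $\xi\to z\}$; the Carathéodory pseudodistance $c^*_D(z,w)=\sup\{|f(w)|: f\in\mathcal O(D,\mathbb D), f(z)=0\}$; the Carathéodory–Reiffen pseudometric $\gamma_D(z,X)=\sup\{|f'(z)X|: f\in\mathcal O(D,\mathbb D), f(z)=0\}$; the Azukawa pseudometric $A_D(z,X)=\limsup_{\lambda\to0}\exp g_D(z,z+\lambda X)/|\lambda|$. *)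

theory Defs
  imports "HOL-Analysis.Analysis"
begin

text \<open>Complex n-space is modelled as complex^'n (Euclidean norm). Coordinates are
  labelled by a bijection sigma from 'n onto {1..n}; coordinate k carries the
  sigma k-th elementary symmetric function.\<close>

definition esym :: "nat \<Rightarrow> complex^'n \<Rightarrow> complex" where
  "esym j l = (\<Sum>S\<in>{S::'n set. card S = j}. \<Prod>i\<in>S. l $ i)"

definition symm_polydisk :: "('n::finite \<Rightarrow> nat) \<Rightarrow> (complex^'n) set" where
  "symm_polydisk \<sigma> = {x. \<exists>l::complex^'n. (\<forall>i. cmod (l $ i) < 1) \<and> (\<forall>k. x $ k = esym (\<sigma> k) l)}"

definition holo_on :: "(complex^'n) set \<Rightarrow> (complex^'n \<Rightarrow> complex) \<Rightarrow> bool" where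
  "holo_on D f \<longleftrightarrow> (\<forall>z\<in>D. \<exists>L. (f has_derivative L) (at z) \<and> (\<forall>c v. L (c *s v) = c * L v))"

definition holo_to_disc :: "(complex^'n) set \<Rightarrow> (complex^'n \<Rightarrow> complex) set" where
  "holo_to_disc D = {f. holo_on D f \<and> f ` D \<subseteq> ball 0 1}"

definition caratheodory_pd :: "(complex^'n) set \<Rightarrow> complex^'n \<Rightarrow> complex^'n \<Rightarrow> real" where
  "caratheodory_pd D z w = Sup {cmod (f w) | f. f \<in> holo_to_disc D \<and> f z = 0}"

definition caratheodory_reiffen :: "(complex^'n) set \<Rightarrow> complex^'n \<Rightarrow> complex^'n \<Rightarrow> real" where
  "caratheodory_reiffen D z X = Sup {cmod (L X) | f L. f \<in> holo_to_disc D \<and> f z = 0 \<and> (f has_derivative L) (at z)}"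

text \<open>Negative plurisubharmonic functions (values in [-inf,0)): upper semicontinuous and
  satisfying the sub-mean value inequality on every closed analytic disc a + zeta b, |zeta| <= 1,
  contained in D. Since u <= 0, the mean value of u equals minus the (nonnegative) integral of -u.\<close>
definition neg_psh :: "(complex^'n) set \<Rightarrow> (complex^'n \<Rightarrow> ereal) \<Rightarrow> bool" where
  "neg_psh D u \<longleftrightarrow>
     (\<forall>x\<in>D. u x < 0) \<and>
     (\<forall>x\<in>D. \<forall>c. u x < c \<longrightarrow> eventually (\<lambda>y. u y < c) (at x within D)) \<and>
     (\<forall>a b. (\<forall>\<zeta>::complex. cmod \<zeta> \<le> 1 \<longrightarrow> a + \<zeta> *s b \<in> D) \<longrightarrow>
        ennreal (1 / (2 * pi)) *
          (\<integral>\<^sup>+ \<theta>. e2ennreal (- u (a + cis \<theta> *s b)) * indicator {0..2*pi} \<theta> \<partial>lborel)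
        \<le> e2ennreal (- u a))"

definition green_fun :: "(complex^'n) set \<Rightarrow> complex^'n \<Rightarrow> complex^'n \<Rightarrow> ereal" where
  "green_fun D z w = Sup {u w | u. neg_psh D u \<and>
      (\<exists>C::real. eventually (\<lambda>\<xi>. u \<xi> \<le> ereal (ln (norm (\<xi> - z))) + ereal C) (at z))}"

definition eexp :: "ereal \<Rightarrow> real" where
  "eexp x = (if x = -\<infinity> then 0 else exp (real_of_ereal x))"

definition azukawa :: "(complex^'n) set \<Rightarrow> complex^'n \<Rightarrow> complex^'n \<Rightarrow> ereal" where
  "azukawa D z X = Limsup (at (0::complex)) (\<lambda>s. ereal (eexp (green_fun D z (z + s *s X)) / cmod s))"

end

theory Submission
  imports Defs "HOL-Complex_Analysis.Complex_Analysis" "HOL-Computational_Algebra.Computational_Algebra"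
begin

text \<open>
Write \<open>M = n - 1\<close>, let \<open>s\<^sub>j\<close> be the coordinates and \<open>p\<^sub>j\<close> the power sums.

Upper bound for \<open>\<gamma>\<close>: let \<open>a = f'(0) e\<^bsub>M\<^esub>\<close> and let \<open>b\<close> be the \<open>M\<close>-th Taylor coefficient of \<open>f\<close> along
\<open>e\<^sub>1\<close>. For a point of the closed polydisc whose only nonzero elementary symmetric functions are
\<open>s\<^sub>1\<close>, \<open>s\<^bsub>M\<^esub>\<close>, \<open>s\<^sub>n\<close>, the Cauchy estimate along the weighted curve \<open>(z\<^sup>j s\<^sub>j)\<close> gives
\<open>\<bar>a s\<^bsub>M\<^esub> + b s\<^sub>1\<^bsup>M\<^esup>\<bar> \<le> 1\<close>. The roots of \<open>(z - 1)(z\<^bsup>M\<^esup> - v)\<close> give \<open>\<bar>a\<bar> + \<bar>b\<bar> \<le> 1\<close>, and those of the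
self-inversive polynomial \<open>z\<^sup>n + X z\<^bsup>M\<^esup> + X' z + 1\<close> (\<open>X'\<close> the conjugate of \<open>X\<close>), which lie on the unit
circle for a suitable \<open>X\<close> of modulus \<open>r = 1 + 3.6 / M\<^sup>2\<close>, give \<open>\<bar>a\<bar> r - \<bar>b\<bar> r\<^bsup>M\<^esup> \<le> 1\<close>. Hence
\<open>\<bar>a\<bar> \<le> (1 + r\<^bsup>M\<^esup>) / (r + r\<^bsup>M\<^esup>)\<close>.

Lower bound for \<open>A\<close>: a polynomial \<open>F\<close> of modulus less than \<open>1\<close> on the domain that vanishes to order \<open>m\<close> at
the origin yields the plurisubharmonic competitor \<open>(ln \<bar>F\<bar>) / m\<close>. For \<open>n \<ge> 4\<close> take \<open>F = p\<^sub>N / n\<close> with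
\<open>N = M\<^sup>2\<close> and \<open>m = M\<close>, which gives \<open>A \<ge> (M / n)\<^bsup>1/M\<^esup>\<close>; for \<open>n = 3\<close> a multiple of \<open>3 p\<^sub>4 - p\<^sub>1 p\<^sub>3\<close>
with \<open>m = 2\<close>.
\<close>

no_notation fps_nth (infixl "$" 75)

section \<open>Elementary symmetric functions and power sums\<close>

lemma prod_add_const_expand:
  fixes x :: "'r::comm_ring_1" and f :: "'n::finite \<Rightarrow> 'r"
  shows "(\<Prod>i\<in>UNIV. x + f i) = (\<Sum>j\<le>CARD('n). x ^ (CARD('n) - j) * (\<Sum>S\<in>{S::'n set. card S = j}. \<Prod>i\<in>S. f i))"
proof -
  have "(\<Prod>i\<in>UNIV. f i + x) = (\<Sum>S\<in>Pow (UNIV::'n set). (\<Prod>i\<in>S. f i) * (\<Prod>i\<in>UNIV - S. x))"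
    by (rule prod_add) simp
  also have "\<dots> = (\<Sum>S\<in>(UNIV::'n set set). x ^ (CARD('n) - card S) * (\<Prod>i\<in>S. f i))"
    by (simp add: card_Diff_subset mult.commute)
  also have "\<dots> = (\<Sum>j\<le>CARD('n). \<Sum>S\<in>{S \<in> (UNIV::'n set set). card S = j}. x ^ (CARD('n) - card S) * (\<Prod>i\<in>S. f i))"
    by (rule sum.group[symmetric]) (auto intro: card_mono)
  also have "\<dots> = (\<Sum>j\<le>CARD('n). x ^ (CARD('n) - j) * (\<Sum>S\<in>{S::'n set. card S = j}. \<Prod>i\<in>S. f i))"
    by (intro sum.cong refl) (auto simp: sum_distrib_left)
  finally show ?thesis by (simp add: add.commute)
qed

lemma esym_neg: "(\<Sum>S\<in>{S::'n::finite set. card S = j}. \<Prod>i\<in>S. - (l $ i)) = (-1) ^ j * esym j l"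
  by (auto simp: esym_def sum_distrib_left prod_uminus intro!: sum.cong)

lemma esym_scale: "esym j (c *s l) = c ^ j * esym j l"
  by (auto simp: esym_def sum_distrib_left prod.distrib intro!: sum.cong)

lemma esym_0 [simp]: "esym 0 l = 1"
proof -
  have "{S::'a set. card S = 0} = {{}}" by (auto simp: card_eq_0_iff)
  thus ?thesis by (simp add: esym_def)
qed

lemma coeff_prod_linear:
  fixes l :: "complex^'n::finite"
  assumes "j \<le> CARD('n)"
  shows "coeff (\<Prod>i\<in>UNIV. [:- (l $ i), 1:]) (CARD('n) - j) = (-1) ^ j * esym j l"
proof -
  let ?n = "CARD('n)"
  have h: "(\<Prod>i\<in>S. [:- (l $ i):]) = [:\<Prod>i\<in>S. - (l $ i):]" for S
    by (induction S rule: infinite_finite_induct) (auto simp: one_pCons)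
  have sm: "(\<Sum>S\<in>X. [:g S:]) = [:\<Sum>S\<in>X. g S:]" for X and g :: "'n set \<Rightarrow> complex"
    by (induction X rule: infinite_finite_induct) auto
  have "(\<Prod>i\<in>UNIV. [:- (l $ i), 1:]) = (\<Prod>i\<in>UNIV. [:0,1:] + [:- (l $ i):])"
    by simp
  also have "\<dots> = (\<Sum>j\<le>?n. [:0,1:] ^ (?n - j) * [:(-1) ^ j * esym j l:])"
    by (simp only: prod_add_const_expand h sm esym_neg)
  also have "\<dots> = (\<Sum>j\<le>?n. monom ((-1) ^ j * esym j l) (?n - j))"
    by (simp add: monom_altdef)
  finally have "coeff (\<Prod>i\<in>UNIV. [:- (l $ i), 1:]) (?n - j) = (\<Sum>k\<le>?n. if ?n - k = ?n - j then (-1) ^ k * esym k l else 0)"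
    by (simp add: coeff_sum)
  also have "\<dots> = (\<Sum>k\<le>?n. if k = j then (-1) ^ k * esym k l else 0)"
    using assms by (intro sum.cong) auto
  finally show ?thesis using assms by simp
qed

lemma ex_roots_vec:
  fixes p :: "complex poly"
  assumes "degree p = CARD('n::finite)" "lead_coeff p = 1"
  obtains l :: "complex^'n" where "p = (\<Prod>i\<in>UNIV. [:- (l $ i), 1:])"
proof -
  obtain A where A: "size A = degree p" "p = smult (lead_coeff p) (\<Prod>x\<in>#A. [:- x, 1:])"
    using alg_closed_imp_factorization[of p] assms by fastforce
  obtain xs where xs: "mset xs = A" by (metis ex_mset)
  have len: "length xs = CARD('n)" using xs A(1) assms(1) by (metis size_mset)
  obtain h where h: "bij_betw h (UNIV::'n set) {..<CARD('n)}"
    using ex_bij_betw_finite_nat[of "UNIV :: 'n set"] by (auto simp: atLeast0LessThan)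
  define l :: "complex^'n" where "l = (\<chi> i. xs ! h i)"
  have "(\<Prod>x\<in>#A. [:- x, 1:]) = prod_list (map (\<lambda>x. [:- x, 1:]) xs)"
    using xs by (metis mset_map prod_mset_prod_list)
  also have "\<dots> = (\<Prod>k<CARD('n). [:- (xs ! k), 1:])"
    using len by (simp add: prod.list_conv_set_nth atLeast0LessThan)
  also have "\<dots> = (\<Prod>i\<in>(UNIV::'n set). [:- (xs ! h i), 1:])"
    using prod.reindex_bij_betw[OF h, of "\<lambda>k. [:- (xs ! k), 1:]"] by simp
  finally show ?thesis using that[of l] A(2) assms(2) by (simp add: l_def)
qed

text \<open>Vieta read backwards: factor the polynomial with coefficients
  \<open>(-1) ^ j * e j\<close> and take its roots as \<open>l\<close>. A bound \<open>P\<close> on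
  the roots turns prescribed coordinates into a point coming from the open or from the closed
  polydisc.\<close>

lemma ex_esym_eq:
  fixes e :: "nat \<Rightarrow> complex"
  assumes "e 0 = 1"
    and roots: "\<And>z. (\<Sum>j\<le>CARD('n::finite). (-1) ^ j * e j * z ^ (CARD('n) - j)) = 0 \<Longrightarrow> P z"
  obtains l :: "complex^'n" where "\<And>i. P (l $ i)" "\<And>j. j \<le> CARD('n) \<Longrightarrow> esym j l = e j"
proof -
  let ?n = "CARD('n)"
  define p where "p = (\<Sum>j\<le>?n. monom ((-1) ^ j * e j) (?n - j))"
  have cf: "coeff p k = (if k \<le> ?n then (-1) ^ (?n - k) * e (?n - k) else 0)" for k
  proof -
    have "coeff p k = (\<Sum>j\<le>?n. if j = ?n - k \<and> k \<le> ?n then (-1) ^ j * e j else 0)"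
      unfolding p_def coeff_sum by (intro sum.cong) auto
    thus ?thesis by (auto simp: sum.If_cases)
  qed
  have dg: "degree p = ?n"
    by (rule antisym[OF degree_le le_degree]) (use assms(1) in \<open>auto simp: cf\<close>)
  have "lead_coeff p = 1" using dg assms(1) by (simp add: cf)
  then obtain l :: "complex^'n" where l: "p = (\<Prod>i\<in>UNIV. [:- (l $ i), 1:])"
    using ex_roots_vec dg by metis
  have "poly p (l $ i) = 0" for i
    unfolding l poly_prod by (rule prod_zero) auto
  hence "P (l $ i)" for i
    by (intro roots) (simp add: p_def poly_sum poly_monom)
  moreover have "esym j l = e j" if "j \<le> ?n" for j
    using coeff_prod_linear[OF that, of l] that by (simp add: l[symmetric] cf)
  ultimately show ?thesis using that by blast
qed

section \<open>Newton's identities by generating functions\<close>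

lemma fps_prod_linear:
  fixes l :: "complex^'n::finite"
  shows "fps_nth (\<Prod>i\<in>UNIV. 1 - fps_const (l $ i) * fps_X) j = (if j \<le> CARD('n) then (-1) ^ j * esym j l else 0)"
proof -
  let ?n = "CARD('n)"
  have h: "(\<Prod>i\<in>S. - (fps_const (l $ i) * fps_X)) = fps_const (\<Prod>i\<in>S. - (l $ i)) * fps_X ^ card S" for S :: "'n set"
    by (induction S rule: infinite_finite_induct) (auto simp: algebra_simps simp flip: fps_const_mult fps_const_neg)
  have "(\<Prod>i\<in>UNIV. 1 - fps_const (l $ i) * fps_X) = (\<Prod>i\<in>UNIV. 1 + - (fps_const (l $ i) * fps_X))"
    by simp
  also have "\<dots> = (\<Sum>j\<le>?n. \<Sum>S\<in>{S::'n set. card S = j}. fps_const (\<Prod>i\<in>S. - (l $ i)) * fps_X ^ j)"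
    by (subst prod_add_const_expand) (simp add: h)
  also have "\<dots> = (\<Sum>j\<le>?n. fps_const ((-1) ^ j * esym j l) * fps_X ^ j)"
  proof (intro sum.cong refl)
    fix j
    have "(\<Sum>S\<in>X. fps_const (g S) * fps_X ^ j) = fps_const (\<Sum>S\<in>X. g S) * fps_X ^ j" for X and g :: "'n set \<Rightarrow> complex"
      by (induction X rule: infinite_finite_induct) (auto simp: algebra_simps simp flip: fps_const_add)
    thus "(\<Sum>S\<in>{S::'n set. card S = j}. fps_const (\<Prod>i\<in>S. - (l $ i)) * fps_X ^ j) = fps_const ((-1) ^ j * esym j l) * fps_X ^ j"
      by (simp only: esym_neg)
  qed
  finally show ?thesis
    by (simp add: fps_sum_nth if_distrib cong: if_cong)
qed

text \<open>Newton's identities, solved for the power sum and used as a recursion. Being polynomial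
  in the \<open>e j\<close>, this makes sense at every point of the coordinate space, without
  reference to roots.\<close>

fun newton_psum :: "(nat \<Rightarrow> complex) \<Rightarrow> nat \<Rightarrow> complex" where
  "newton_psum e N = (-1) ^ (N + 1) * of_nat N * e N + (\<Sum>j\<in>{1..<N}. (-1) ^ (j + 1) * e j * newton_psum e (N - j))"
declare newton_psum.simps [simp del]

text \<open>Logarithmic differentiation of \<open>E\<close>, the product of the factors
  \<open>1 - l_i X\<close>. Here \<open>G i\<close> is the geometric series of
  \<open>l_i / (1 - l_i X)\<close>, and the sum of the \<open>G i\<close> generates the power sums;
  comparing coefficients in \<open>fps_deriv E\<close> gives Newton's identities.\<close>

lemma newton_psum_esym:
  fixes l :: "complex^'n::finite"
  assumes e: "\<And>j. e j = (if j \<le> CARD('n) then esym j l else 0)" and N: "N \<ge> 1"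
  shows "newton_psum e N = (\<Sum>i\<in>UNIV. (l $ i) ^ N)"
proof -
  define E where "E = (\<Prod>i\<in>UNIV. 1 - fps_const (l $ i) * fps_X)"
  define G where "G i = Abs_fps (\<lambda>N. (l $ i) ^ Suc N)" for i
  have En: "fps_nth E j = (-1) ^ j * e j" for j
    by (simp add: E_def fps_prod_linear e)
  have G: "(1 - fps_const (l $ i) * fps_X) * G i = fps_const (l $ i)" for i
  proof (rule fps_ext)
    fix k show "fps_nth ((1 - fps_const (l $ i) * fps_X) * G i) k = fps_nth (fps_const (l $ i)) k"
      by (cases k) (auto simp: G_def left_diff_distrib mult.assoc)
  qed
  have "fps_deriv (\<Prod>i\<in>A. 1 - fps_const (l $ i) * fps_X) = - (\<Prod>i\<in>A. 1 - fps_const (l $ i) * fps_X) * (\<Sum>i\<in>A. G i)" for A :: "'n set"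
  proof (induction A rule: infinite_finite_induct)
    case (insert x A)
    define c where "c = fps_const (l $ x)"
    define P where "P = (\<Prod>i\<in>A. 1 - fps_const (l $ i) * fps_X)"
    have c: "(1 - c * fps_X) * G x = c" by (simp add: c_def G)
    have d: "fps_deriv (1 - c * fps_X) = - c"
      by (simp add: c_def)
    have "fps_deriv ((1 - c * fps_X) * P) = - c * P + (1 - c * fps_X) * fps_deriv P"
      using d by (simp add: algebra_simps)
    also have "fps_deriv P = - P * (\<Sum>i\<in>A. G i)"
      using insert.IH by (simp add: P_def)
    also have "- c * P + (1 - c * fps_X) * (- P * (\<Sum>i\<in>A. G i)) = - ((1 - c * fps_X) * P) * (\<Sum>i\<in>insert x A. G i)"
    proof -
      have "- ((1 - c * fps_X) * P) * (\<Sum>i\<in>insert x A. G i) = - P * ((1 - c * fps_X) * G x) + (1 - c * fps_X) * (- P * (\<Sum>i\<in>A. G i))"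
        using insert.hyps by (simp add: algebra_simps)
      thus ?thesis by (simp only: c) (simp add: algebra_simps)
    qed
    also have "(1 - c * fps_X) * P = (\<Prod>i\<in>insert x A. 1 - fps_const (l $ i) * fps_X)"
      using insert.hyps by (simp add: P_def c_def)
    finally show ?case .
  qed auto
  hence dE: "fps_deriv E = - E * (\<Sum>i\<in>UNIV. G i)" by (simp add: E_def)
  define p where "p N = (\<Sum>i\<in>UNIV. (l $ i) ^ N)" for N
  have Sn: "fps_nth (\<Sum>i\<in>UNIV. G i) k = p (Suc k)" for k
    by (simp add: fps_sum_nth G_def p_def)
  have rec: "p N = (-1) ^ (N + 1) * of_nat N * e N + (\<Sum>j\<in>{1..<N}. (-1) ^ (j + 1) * e j * p (N - j))"
    if N1: "N \<ge> 1" for N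
  proof -
    obtain M where M: "N = Suc M" using N1 by (cases N) auto
    have "fps_nth (fps_deriv E) M = - (\<Sum>j=0..M. (-1) ^ j * e j * p (Suc (M - j)))"
      unfolding dE by (simp add: fps_mult_nth Sn En)
    hence "of_nat N * ((-1) ^ N * e N) = - (\<Sum>j=0..M. (-1) ^ j * e j * p (N - j))"
      by (simp add: En M Suc_diff_le)
    \<comment> \<open>The term \<open>j = 0\<close> is \<open>p N\<close>; the range ends at
      \<open>N - 1\<close>, so \<open>e N\<close> enters only through the left side.\<close>
    also have "(\<Sum>j=0..M. (-1) ^ j * e j * p (N - j)) = p N + (\<Sum>j\<in>{1..<N}. (-1) ^ j * e j * p (N - j))"
      by (subst sum.atLeast_Suc_atMost) (auto simp: M e atLeastLessThanSuc_atLeastAtMost)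
    finally have "p N = - (of_nat N * ((-1) ^ N * e N)) - (\<Sum>j\<in>{1..<N}. (-1) ^ j * e j * p (N - j))"
      by (metis (no_types, lifting) add_diff_cancel minus_minus)
    also have "\<dots> = (-1) ^ (N + 1) * of_nat N * e N + (\<Sum>j\<in>{1..<N}. (-1) ^ (j + 1) * e j * p (N - j))"
      by (simp add: sum_negf)
    finally show ?thesis .
  qed
  have "newton_psum e N = p N" using N
  proof (induction N rule: less_induct)
    case (less N)
    show ?case
      by (subst newton_psum.simps, subst rec[OF less.prems])
         (intro arg_cong2[where f="(+)"] refl sum.cong, use less.IH in auto)
  qed
  thus ?thesis by (simp add: p_def)
qed

section \<open>A lower bound for the Green function\<close>

text \<open>Since \<open>1 - w * z\<close> has positive real part on the closed disc,
  \<open>Ln (1 - w * z)\<close> is holomorphic there, and its mean over the circle is its value 0 at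
  the origin.\<close>

lemma has_integral_ln_cmod_one_minus:
  assumes "cmod w < 1"
  shows "((\<lambda>\<theta>. ln (cmod (1 - w * cis \<theta>))) has_integral 0) {0..2*pi}"
proof -
  have pos: "Re (1 - w * z) > 0" if "z \<in> cball 0 1" for z
  proof -
    have "cmod (w * z) \<le> cmod w * 1" using that unfolding norm_mult by (intro mult_left_mono) auto
    thus ?thesis using assms complex_Re_le_cmod[of "w * z"] by simp
  qed
  hence nz: "1 - w * z \<notin> \<real>\<^sub>\<le>\<^sub>0" if "z \<in> cball 0 1" for z
    using that by (force simp: complex_nonpos_Reals_iff)
  have "(\<lambda>z. Ln (1 - w * z)) holomorphic_on cball 0 1"
    by (intro holomorphic_intros) (use nz in auto)
  from Cauchy_integral_circlepath_simple[OF this, of 0]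
  have "((\<lambda>u. Ln (1 - w * u) / u) has_contour_integral 0) (part_circlepath 0 1 0 (2*pi))"
    by (simp add: circlepath_def)
  hence "((\<lambda>t. Ln (1 - w * cis t) / cis t * \<i> * cis t) has_integral 0) {0..2*pi}"
    by (subst (asm) has_contour_integral_part_circlepath_iff) auto
  \<comment> \<open>The integrand is \<open>\<i> * Ln (1 - w * cis t)\<close>, whose imaginary part
    is the real part of the logarithm.\<close>
  from has_integral_linear[OF this bounded_linear_Im]
  have "((\<lambda>t. Re (Ln (1 - w * cis t))) has_integral 0) {0..2*pi}"
    by (simp add: o_def field_simps)
  thus ?thesis
  proof (rule has_integral_eq[rotated])
    fix t
    have "1 - w * cis t \<noteq> 0" using pos[of "cis t"] by (metis less_irrefl mem_cball_0 norm_cis order_refl zero_complex.sel(1))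
    thus "Re (Ln (1 - w * cis t)) = ln (cmod (1 - w * cis t))" by simp
  qed
qed

text \<open>Jensen's formula for one linear factor. A zero outside the circle is pulled out as a
  constant; a zero inside is reflected to the outside without changing the modulus on the circle,
  and the integral becomes \<open>2 * pi * ln \<rho>\<close>, which is larger.\<close>

lemma ln_cmod_linear_mean:
  assumes "\<rho> > 0" "x \<noteq> 0" "cmod x \<noteq> \<rho>"
  shows "\<exists>I \<ge> 2 * pi * ln (cmod x). ((\<lambda>\<theta>. ln (cmod (\<rho> * cis \<theta> - x))) has_integral I) {0..2*pi}"
proof -
  have gen: "\<exists>I. I = 2 * pi * ln c \<and> ((\<lambda>\<theta>. ln (cmod (\<rho> * cis \<theta> - x))) has_integral I) {0..2*pi}"
    if c: "c > 0" and w: "cmod w < 1" and eq: "\<And>\<theta>. cmod (\<rho> * cis \<theta> - x) = c * cmod (1 - w * cis \<theta>)" for c w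
  proof -
    have nz: "1 - w * cis t \<noteq> 0" for t
    proof
      assume "1 - w * cis t = 0"
      hence "cmod (w * cis t) = 1" by simp
      thus False using w by (simp add: norm_mult)
    qed
    have "((\<lambda>\<theta>. ln c + ln (cmod (1 - w * cis \<theta>))) has_integral (2 * pi * ln c + 0)) {0..2*pi}"
      using has_integral_const_real[of "ln c" 0 "2*pi"]
      by (intro has_integral_add has_integral_ln_cmod_one_minus[OF w]) simp_all
    moreover have "ln c + ln (cmod (1 - w * cis \<theta>)) = ln (cmod (\<rho> * cis \<theta> - x))" for \<theta>
      using c nz[of \<theta>] by (simp add: eq ln_mult)
    ultimately show ?thesis by auto
  qed
  show ?thesis
  proof (cases "cmod x > \<rho>")
    case True
    have "cmod (\<rho> * cis \<theta> - x) = cmod x * cmod (1 - (\<rho> / x) * cis \<theta>)" for \<theta>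
      using assms(2) by (simp flip: norm_mult add: algebra_simps norm_minus_commute)
    moreover have "cmod (\<rho> / x) < 1" using True assms by (simp add: norm_divide)
    ultimately show ?thesis using gen[of "cmod x" "\<rho> / x"] assms(2) by auto
  next
    case False
    have "cmod (\<rho> * cis \<theta> - x) = \<rho> * cmod (1 - (cnj x / \<rho>) * cis \<theta>)" for \<theta>
    proof -
      have h: "cis \<theta> * (x * cnj (cis \<theta>)) = x" by (simp add: cis_cnj cis_mult mult.left_commute[of _ x])
      have "\<rho> * cis \<theta> - x = cis \<theta> * cnj (\<rho> - cnj x * cis \<theta>)"
        using h by (simp add: algebra_simps)
      hence "cmod (\<rho> * cis \<theta> - x) = cmod (\<rho> - cnj x * cis \<theta>)"
        by (simp only: norm_mult complex_mod_cnj norm_cis)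
      also have "\<rho> - cnj x * cis \<theta> = \<rho> * (1 - (cnj x / \<rho>) * cis \<theta>)"
        using assms(1) by (simp add: algebra_simps)
      also have "cmod \<dots> = \<rho> * cmod (1 - (cnj x / \<rho>) * cis \<theta>)"
        using assms(1) by (simp add: norm_mult)
      finally show ?thesis .
    qed
    moreover have "cmod (cnj x / \<rho>) < 1" using False assms by (simp add: norm_divide)
    moreover have "2 * pi * ln (cmod x) \<le> 2 * pi * ln \<rho>"
      using False assms by simp
    ultimately show ?thesis using gen[of \<rho> "cnj x / \<rho>"] assms(1) by metis
  qed
qed

text \<open>The logarithm turns the factorization into a sum, so the bounds of
  \<open>ln_cmod_linear_mean\<close> add up.\<close>

lemma ln_cmod_poly_mean:
  fixes q :: "complex poly"
  assumes \<rho>: "\<rho> > 0" and q0: "poly q 0 \<noteq> 0" and roots: "\<And>x. poly q x = 0 \<Longrightarrow> cmod x \<noteq> \<rho>"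
  shows "\<exists>I \<ge> 2 * pi * ln (cmod (poly q 0)). ((\<lambda>\<theta>. ln (cmod (poly q (\<rho> * cis \<theta>)))) has_integral I) {0..2*pi}"
proof -
  obtain A where A: "q = smult (lead_coeff q) (\<Prod>x\<in>#A. [:- x, 1:])"
    using alg_closed_imp_factorization[of q] q0 by fastforce
  define c where "c = lead_coeff q"
  have c: "c \<noteq> 0" using q0 by (auto simp: c_def)
  have "\<exists>I \<ge> 2 * pi * ln (cmod (poly (smult c (\<Prod>x\<in>#A. [:- x, 1:])) 0)).
      ((\<lambda>\<theta>. ln (cmod (poly (smult c (\<Prod>x\<in>#A. [:- x, 1:])) (\<rho> * cis \<theta>)))) has_integral I) {0..2*pi}"
    if "poly (smult c (\<Prod>x\<in>#A. [:- x, 1:])) 0 \<noteq> 0"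
       "\<And>x. poly (smult c (\<Prod>x\<in>#A. [:- x, 1:])) x = 0 \<Longrightarrow> cmod x \<noteq> \<rho>" for A
    using that
  proof (induction A)
    case empty
    show ?case using has_integral_const_real[of "ln (cmod c)" 0 "2*pi"] by auto
  next
    case (add x A)
    define p where "p = smult c (\<Prod>x\<in>#A. [:- x, 1:])"
    have e: "smult c (\<Prod>x\<in>#add_mset x A. [:- x, 1:]) = [:- x, 1:] * p"
      by (simp add: p_def)
    have p: "poly p 0 \<noteq> 0" "\<And>z. poly p z = 0 \<Longrightarrow> cmod z \<noteq> \<rho>" and x: "x \<noteq> 0" "cmod x \<noteq> \<rho>"
      using add.prems unfolding e by auto
    obtain I where I: "I \<ge> 2 * pi * ln (cmod (poly p 0))" "((\<lambda>\<theta>. ln (cmod (poly p (\<rho> * cis \<theta>)))) has_integral I) {0..2*pi}"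
      using add.IH p unfolding p_def by blast
    obtain J where J: "J \<ge> 2 * pi * ln (cmod x)" "((\<lambda>\<theta>. ln (cmod (\<rho> * cis \<theta> - x))) has_integral J) {0..2*pi}"
      using ln_cmod_linear_mean[OF \<rho> x] by blast
    have n: "cmod (\<rho> * cis \<theta>) = \<rho>" for \<theta> using \<rho> by (simp add: norm_mult)
    have s: "ln (cmod (\<rho> * cis \<theta> - x)) + ln (cmod (poly p (\<rho> * cis \<theta>))) = ln (cmod (poly ([:- x, 1:] * p) (\<rho> * cis \<theta>)))" for \<theta>
    proof -
      have "poly p (\<rho> * cis \<theta>) \<noteq> 0" using p(2) n by blast
      moreover have "\<rho> * cis \<theta> - x \<noteq> 0" using n[of \<theta>] x(2) by auto
      moreover have "poly ([:- x, 1:] * p) (\<rho> * cis \<theta>) = (\<rho> * cis \<theta> - x) * poly p (\<rho> * cis \<theta>)"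
        by (simp add: algebra_simps)
      ultimately show ?thesis by (simp add: norm_mult ln_mult)
    qed
    have "((\<lambda>\<theta>. ln (cmod (poly ([:- x, 1:] * p) (\<rho> * cis \<theta>)))) has_integral (J + I)) {0..2*pi}"
      using has_integral_add[OF J(2) I(2)] by (simp only: s)
    moreover have "2 * pi * ln (cmod (poly ([:- x, 1:] * p) 0)) \<le> J + I"
    proof -
      have "ln (cmod (poly ([:- x, 1:] * p) 0)) = ln (cmod x) + ln (cmod (poly p 0))"
        using x p by (simp add: norm_mult ln_mult)
      thus ?thesis using I(1) J(1) by (simp add: algebra_simps)
    qed
    ultimately show ?case unfolding e by blast
  qed
  thus ?thesis using q0 roots A unfolding c_def by metis
qed

text \<open>Provides radii increasing to 1 whose circles avoid the zeros: there are finitely many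
  zeros, and the radii are distinct.\<close>

lemma eventually_poly_nonzero_circle:
  fixes q :: "complex poly"
  assumes "q \<noteq> 0"
  shows "\<forall>\<^sub>F k in sequentially. \<forall>x. poly q x = 0 \<longrightarrow> cmod x \<noteq> 1 - 1 / real (k + 2)"
proof -
  have "\<forall>\<^sub>F k in sequentially. cmod x \<noteq> 1 - 1 / real (k + 2)" for x
  proof -
    have "inj (\<lambda>k. 1 - 1 / real (k + 2))" by (auto simp: inj_def)
    hence "finite {k. cmod x = 1 - 1 / real (k + 2)}"
      using finite_vimageI[of "{cmod x}" "\<lambda>k. 1 - 1 / real (k + 2)"] by (simp add: vimage_def eq_commute)
    thus ?thesis by (simp flip: cofinite_eq_sequentially add: eventually_cofinite)
  qed
  hence "\<forall>\<^sub>F k in sequentially. \<forall>x\<in>{x. poly q x = 0}. cmod x \<noteq> 1 - 1 / real (k + 2)"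
    using poly_roots_finite[OF assms] by (subst eventually_ball_finite_distrib) auto
  thus ?thesis by simp
qed

lemma AE_poly_cis_nonzero:
  fixes q :: "complex poly"
  assumes qnz: "q \<noteq> 0"
  shows "AE \<theta> in lborel. \<theta> \<in> {0..2*pi} \<longrightarrow> poly q (cis \<theta>) \<noteq> 0"
proof -
  have fin: "finite {\<theta> \<in> {0..2*pi}. poly q (cis \<theta>) = 0}"
  proof -
    \<comment> \<open>The endpoint \<open>2*pi\<close> is separated because \<open>Arg2pi\<close>
      takes its values in the half-open interval.\<close>
    have "{\<theta> \<in> {0..2*pi}. poly q (cis \<theta>) = 0} \<subseteq> (Arg2pi ` {x. poly q x = 0}) \<union> {2*pi}"
    proof
      fix \<theta> assume t: "\<theta> \<in> {\<theta> \<in> {0..2*pi}. poly q (cis \<theta>) = 0}"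
      show "\<theta> \<in> (Arg2pi ` {x. poly q x = 0}) \<union> {2*pi}"
      proof (cases "\<theta> = 2*pi")
        case False
        hence "Arg2pi (cis \<theta>) = \<theta>" using t
          by (intro Arg2pi_unique[of 1]) (auto simp: cis_conv_exp)
        thus ?thesis using t by (metis (mono_tags, lifting) UnI1 image_eqI mem_Collect_eq)
      qed auto
    qed
    thus ?thesis using poly_roots_finite[OF qnz] by (meson finite.emptyI finite_UnI finite_imageI finite_insert finite_subset)
  qed
  have ae: "AE \<theta> in lborel. \<theta> \<notin> {\<theta> \<in> {0..2*pi}. poly q (cis \<theta>) = 0}"
    by (rule AE_not_in) (use fin in \<open>auto intro: finite_imp_null_set_lborel\<close>)
  thus ?thesis by eventually_elim auto
qed

text \<open>As \<open>q\<close> may vanish on the unit circle, the inequality is first obtained on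
  circles of radius \<open>\<rho> k\<close> free of zeros and then carried to the limit by Fatou's
  lemma. The bound on \<open>q\<close> makes the integrands nonnegative.\<close>

lemma jensen_inequality_nn_integral:
  fixes q :: "complex poly"
  assumes q0: "poly q 0 \<noteq> 0" and le: "\<And>z. cmod z \<le> 1 \<Longrightarrow> cmod (poly q z) \<le> 1" and c: "c \<ge> 0"
  shows "(\<integral>\<^sup>+ \<theta>. ennreal (- (c * ln (cmod (poly q (cis \<theta>))))) * indicator {0..2*pi} \<theta> \<partial>lborel)
     \<le> ennreal (2 * pi * (- (c * ln (cmod (poly q 0)))))"
proof -
  have qnz: "q \<noteq> 0" using q0 by auto
  define \<rho> where "\<rho> k = 1 - 1 / real (k + 2)" for k
  have \<rho>: "\<rho> k > 0" "\<rho> k < 1" for k by (auto simp: \<rho>_def)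
  have lim: "\<rho> \<longlonglongrightarrow> 1" unfolding \<rho>_def by real_asymp
  define g where "g k \<theta> = ennreal (- (c * ln (cmod (poly q (\<rho> k * cis \<theta>))))) * indicator {0..2*pi} \<theta>" for k \<theta>
  have meas: "g k \<in> borel_measurable lborel" for k
  proof -
    have "(\<lambda>\<theta>. poly q (\<rho> k * cis \<theta>)) \<in> borel_measurable borel"
      by (intro borel_measurable_continuous_onI continuous_intros)
    thus ?thesis unfolding g_def by measurable
  qed
  have "(\<integral>\<^sup>+ \<theta>. ennreal (- (c * ln (cmod (poly q (cis \<theta>))))) * indicator {0..2*pi} \<theta> \<partial>lborel)
     \<le> (\<integral>\<^sup>+ \<theta>. liminf (\<lambda>k. g k \<theta>) \<partial>lborel)"
  proof (rule nn_integral_mono_AE, use AE_poly_cis_nonzero[OF qnz] in eventually_elim)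
    case (elim \<theta>)
    show ?case
    proof (cases "\<theta> \<in> {0..2*pi}")
      case True
      hence nz: "poly q (cis \<theta>) \<noteq> 0" using elim by auto
      have "(\<lambda>k. poly q (\<rho> k * cis \<theta>)) \<longlonglongrightarrow> poly q (complex_of_real 1 * cis \<theta>)"
        by (intro tendsto_intros lim)
      from tendsto_norm[OF this] have "(\<lambda>k. ln (cmod (poly q (\<rho> k * cis \<theta>)))) \<longlonglongrightarrow> ln (cmod (poly q (cis \<theta>)))"
        using nz by (intro tendsto_ln) auto
      hence "(\<lambda>k. ennreal (- (c * ln (cmod (poly q (\<rho> k * cis \<theta>)))))) \<longlonglongrightarrow> ennreal (- (c * ln (cmod (poly q (cis \<theta>)))))"
        by (intro tendsto_ennrealI tendsto_minus tendsto_mult tendsto_const)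
      hence "liminf (\<lambda>k. g k \<theta>) = ennreal (- (c * ln (cmod (poly q (cis \<theta>)))))"
        using True unfolding g_def by (intro lim_imp_Liminf) auto
      thus ?thesis using True by simp
    qed auto
  qed
  also have "\<dots> \<le> liminf (\<lambda>k. integral\<^sup>N lborel (g k))"
    by (rule nn_integral_liminf) (rule meas)
  also have "\<dots> \<le> ennreal (2 * pi * (- (c * ln (cmod (poly q 0)))))"
  proof (rule Liminf_le)
    show "\<forall>\<^sub>F k in sequentially. integral\<^sup>N lborel (g k) \<le> ennreal (2 * pi * (- (c * ln (cmod (poly q 0)))))"
      using eventually_poly_nonzero_circle[OF qnz]
    proof eventually_elim
      case (elim k)
      obtain I where I: "I \<ge> 2 * pi * ln (cmod (poly q 0))"
        "((\<lambda>\<theta>. ln (cmod (poly q (\<rho> k * cis \<theta>)))) has_integral I) {0..2*pi}"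
        using ln_cmod_poly_mean[OF \<rho>(1) q0, of k] elim unfolding \<rho>_def by blast
      have le0: "ln (cmod (poly q (\<rho> k * cis \<theta>))) \<le> 0" for \<theta>
      proof -
        have "cmod (poly q (\<rho> k * cis \<theta>)) \<le> 1"
          using \<rho>[of k] by (intro le) (simp add: norm_mult)
        thus ?thesis by (cases "poly q (\<rho> k * cis \<theta>) = 0") auto
      qed
      have hi: "((\<lambda>\<theta>. - (c * ln (cmod (poly q (\<rho> k * cis \<theta>))))) has_integral - (c * I)) {0..2*pi}"
        using I(2) by (intro has_integral_neg has_integral_mult_right)
      have "integral\<^sup>N lborel (g k) = ennreal (- (c * I))"
      proof -
        have "g k = (\<lambda>\<theta>. ennreal (indicator {0..2*pi} \<theta> * - (c * ln (cmod (poly q (\<rho> k * cis \<theta>))))))"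
          by (auto simp: g_def indicator_def fun_eq_iff)
        thus ?thesis
          using nn_integral_has_integral_lebesgue[OF _ hi] le0 c by (simp add: mult_nonneg_nonpos)
      qed
      also have "\<dots> \<le> ennreal (2 * pi * (- (c * ln (cmod (poly q 0)))))"
        using mult_left_mono[OF I(1) c] by (intro ennreal_leI) (simp add: algebra_simps)
      finally show ?case .
    qed
  qed auto
  finally show ?thesis .
qed

text \<open>The competitor is \<open>ln |F| / m\<close>. Since \<open>F\<close> restricts to a
  polynomial on each complex line, the submean inequality on a disc is Jensen's inequality for that
  polynomial; dividing by \<open>m\<close> turns vanishing of order \<open>m\<close> into a
  logarithmic pole of weight one.\<close>

lemma green_fun_lower_bound:
  fixes F :: "complex^'n::finite \<Rightarrow> complex"
  assumes lines: "\<And>a b. \<exists>q. \<forall>\<zeta>. F (a + \<zeta> *s b) = poly q \<zeta>"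
    and cont: "continuous_on UNIV F"
    and lt1: "\<And>x. x \<in> D \<Longrightarrow> cmod (F x) < 1"
    and m: "m \<ge> 1"
    and ord: "\<forall>\<^sub>F \<xi> in at 0. cmod (F \<xi>) \<le> K * norm \<xi> ^ m"
    and w: "w \<in> D" "F w \<noteq> 0"
  shows "exp (ln (cmod (F w)) / m) \<le> eexp (green_fun D 0 w)"
proof -
  define u where "u x = (if F x = 0 then -\<infinity> else ereal (ln (cmod (F x)) / m))" for x
  \<comment> \<open>This equivalence also covers the zeros of \<open>F\<close> and reduces upper
    semicontinuity of \<open>u\<close> to continuity of \<open>|F|\<close>.\<close>
  have u_less: "u y < ereal r \<longleftrightarrow> cmod (F y) < exp (r * m)" for y r
  proof (cases "F y = 0")
    case False
    have "ln (cmod (F y)) / m < r \<longleftrightarrow> ln (cmod (F y)) < r * m"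
      using m by (simp add: field_simps)
    also have "\<dots> \<longleftrightarrow> cmod (F y) < exp (r * m)"
      using False by (metis exp_less_cancel_iff exp_ln zero_less_norm_iff)
    finally show ?thesis using False by (simp add: u_def)
  qed (auto simp: u_def)
  have neg: "u x < 0" if "x \<in> D" for x
    using u_less[of x 0] lt1[OF that] by (simp add: zero_ereal_def)
  have "neg_psh D u"
    unfolding neg_psh_def
  proof (intro conjI ballI allI impI)
    fix x c assume x: "x \<in> D" and c: "u x < c"
    show "\<forall>\<^sub>F y in at x within D. u y < c"
    proof (cases c)
      case (real r)
      have "(F \<longlongrightarrow> F x) (at x within D)"
        using cont by (auto simp: continuous_on_def intro: tendsto_within_subset)
      hence "((\<lambda>y. cmod (F y)) \<longlongrightarrow> cmod (F x)) (at x within D)"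
        by (rule tendsto_norm)
      thus ?thesis using c unfolding real u_less by (rule order_tendstoD(2))
    qed (use c in \<open>auto simp: u_def\<close>)
  next
    fix a b assume disc: "\<forall>\<zeta>::complex. cmod \<zeta> \<le> 1 \<longrightarrow> a + \<zeta> *s b \<in> D"
    obtain q where q: "\<And>\<zeta>. F (a + \<zeta> *s b) = poly q \<zeta>" using lines by blast
    show "ennreal (1 / (2 * pi)) *
          (\<integral>\<^sup>+ \<theta>. e2ennreal (- u (a + cis \<theta> *s b)) * indicator {0..2*pi} \<theta> \<partial>lborel)
        \<le> e2ennreal (- u a)"
    proof (cases "F a = 0")
      \<comment> \<open>Here the right-hand side of the submean inequality is infinite.\<close>
      case True
      thus ?thesis by (simp add: u_def)
    next
      case False
      have a: "F a = poly q 0" using q[of 0] by simp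
      have q0: "poly q 0 \<noteq> 0" using False a by simp
      have le: "cmod (poly q z) \<le> 1" if "cmod z \<le> 1" for z
        using lt1[of "a + z *s b"] disc that by (simp add: q less_imp_le)
      have "(\<integral>\<^sup>+ \<theta>. e2ennreal (- u (a + cis \<theta> *s b)) * indicator {0..2*pi} \<theta> \<partial>lborel)
        \<le> (\<integral>\<^sup>+ \<theta>. ennreal (- (1 / m * ln (cmod (poly q (cis \<theta>))))) * indicator {0..2*pi} \<theta> \<partial>lborel)"
      proof (rule nn_integral_mono_AE)
        have "q \<noteq> 0" using q0 by auto
        from AE_poly_cis_nonzero[OF this]
        show "AE \<theta> in lborel. e2ennreal (- u (a + cis \<theta> *s b)) * indicator {0..2*pi} \<theta>
          \<le> ennreal (- (1 / m * ln (cmod (poly q (cis \<theta>))))) * indicator {0..2*pi} \<theta>"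
          by eventually_elim (auto simp: u_def q indicator_def)
      qed
      also have "\<dots> \<le> ennreal (2 * pi * (- (1 / m * ln (cmod (poly q 0)))))"
        by (rule jensen_inequality_nn_integral[OF q0 le]) auto
      finally have "ennreal (1 / (2 * pi)) *
          (\<integral>\<^sup>+ \<theta>. e2ennreal (- u (a + cis \<theta> *s b)) * indicator {0..2*pi} \<theta> \<partial>lborel)
        \<le> ennreal (1 / (2 * pi)) * ennreal (2 * pi * (- (1 / m * ln (cmod (poly q 0)))))"
        by (rule mult_left_mono) simp
      also have "\<dots> = ennreal (- (1 / m * ln (cmod (poly q 0))))"
        by (simp flip: ennreal_mult')
      also have "\<dots> = e2ennreal (- u a)"
        using False by (simp add: u_def a)
      finally show ?thesis .
    qed
  qed (use neg in auto)
  moreover have "\<exists>C::real. \<forall>\<^sub>F \<xi> in at 0. u \<xi> \<le> ereal (ln (norm (\<xi> - 0))) + ereal C"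
  proof (intro exI)
    \<comment> \<open>Enlarging \<open>K\<close> to a positive constant gives \<open>ln L\<close> a
      meaning.\<close>
    define L where "L = max K 1"
    have L: "L > 0" "K \<le> L" by (auto simp: L_def)
    show "\<forall>\<^sub>F \<xi> in at 0. u \<xi> \<le> ereal (ln (norm (\<xi> - 0))) + ereal (ln L / m)"
      using ord eventually_neq_at_within[of 0]
    proof eventually_elim
      case (elim \<xi>)
      show ?case
      proof (cases "F \<xi> = 0")
        case False
        have "cmod (F \<xi>) \<le> L * norm \<xi> ^ m"
          using elim L(2) by (smt (verit, best) mult_right_mono norm_ge_zero zero_le_power)
        hence "ln (cmod (F \<xi>)) \<le> ln (L * norm \<xi> ^ m)"
          using False by (subst ln_le_cancel_iff) (use L elim in auto)
        also have "\<dots> = ln L + m * ln (norm \<xi>)"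
          using L elim by (simp add: ln_mult ln_realpow)
        finally have "ln (cmod (F \<xi>)) / m \<le> ln (norm \<xi>) + ln L / m"
          using m by (simp add: field_simps)
        thus ?thesis using False by (simp add: u_def)
      qed (simp add: u_def)
    qed
  qed
  ultimately have "u w \<le> green_fun D 0 w"
    unfolding green_fun_def by (intro Sup_upper) auto
  \<comment> \<open>Squeezed between the finite value \<open>u w\<close> and 0, the Green function
    is finite at \<open>w\<close>, so \<open>eexp\<close> is the ordinary exponential there.\<close>
  moreover have "green_fun D 0 w \<le> 0"
    unfolding green_fun_def using w(1) by (intro Sup_least) (auto simp: neg_psh_def intro: less_imp_le)
  ultimately obtain r where r: "green_fun D 0 w = ereal r" "ln (cmod (F w)) / m \<le> r"
    using w(2) by (cases "green_fun D 0 w") (auto simp: u_def)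
  thus ?thesis by (simp add: eexp_def)
qed

section \<open>Curves and strict differentiability\<close>

lemma norm_cvec_scale: "norm (c *s v) = cmod c * norm (v :: complex^'n::finite)"
  by (simp add: norm_vec_def norm_mult L2_set_right_distrib)

lemma bounded_linear_cvec_scale: "bounded_linear (\<lambda>c. c *s (v :: complex^'n::finite))"
  by (rule bounded_linear_intro[where K = "norm v"])
     (auto simp: norm_cvec_scale vec_eq_iff algebra_simps)

lemma has_derivative_scale_left:
  fixes v :: "complex^'n::finite"
  assumes "(c has_field_derivative c') (at z)"
  shows "((\<lambda>z. c z *s v) has_derivative (\<lambda>h. h *s (c' *s v))) (at z)"
proof -
  have "((\<lambda>z. c z *s v) has_derivative (\<lambda>h. (c' * h) *s v)) (at z)"
    using bounded_linear.has_derivative[OF bounded_linear_cvec_scale, of c] assms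
    unfolding has_field_derivative_def by blast
  thus ?thesis by (simp add: mult.commute)
qed

lemma has_field_derivative_comp_vec:
  fixes f :: "complex^'n::finite \<Rightarrow> complex"
  assumes "(\<gamma> has_derivative (\<lambda>h. h *s v)) (at z)" "(f has_derivative L) (at (\<gamma> z))"
    and "\<And>c v. L (c *s v) = c * L v"
  shows "((\<lambda>z. f (\<gamma> z)) has_field_derivative L v) (at z)"
proof -
  have "(*) (L v) = (\<lambda>h. L (h *s v))" using assms(3) by (auto simp: mult.commute)
  thus ?thesis using has_derivative_compose[OF assms(1,2)] by (simp add: has_field_derivative_def)
qed

lemma holo_on_deriv:
  assumes "holo_on D f" "z \<in> D" "(f has_derivative L) (at z)"
  shows "L (c *s v) = c * L v"
proof -
  obtain L' where "(f has_derivative L') (at z)" "\<And>c v. L' (c *s v) = c * L' v"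
    using assms(1,2) unfolding holo_on_def by blast
  thus ?thesis using has_derivative_unique[OF assms(3)] by blast
qed

lemma holomorphic_on_comp_vec:
  fixes f :: "complex^'n::finite \<Rightarrow> complex"
  assumes "holo_on D f" "\<And>z. z \<in> S \<Longrightarrow> \<gamma> z \<in> D"
    and "\<And>z. z \<in> S \<Longrightarrow> \<exists>v. (\<gamma> has_derivative (\<lambda>h. h *s v)) (at z)"
  shows "(\<lambda>z. f (\<gamma> z)) holomorphic_on S"
  unfolding holomorphic_on_def
proof
  fix z assume z: "z \<in> S"
  obtain L where L: "(f has_derivative L) (at (\<gamma> z))" "\<And>c v. L (c *s v) = c * L v"
    using assms(1) assms(2)[OF z] unfolding holo_on_def by blast
  obtain v where "(\<gamma> has_derivative (\<lambda>h. h *s v)) (at z)" using assms(3) z by blast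
  from has_field_derivative_comp_vec[OF this L]
  show "(\<lambda>z. f (\<gamma> z)) field_differentiable at z within S"
    using field_differentiable_at_within field_differentiable_def by blast
qed

text \<open>Cauchy's estimate on circles of radius less than 1, followed by a limit, because
  \<open>g\<close> is controlled on the open disc only.\<close>

lemma higher_deriv_unit_disc_bound:
  assumes g: "g holomorphic_on ball 0 1" and le: "\<And>z. cmod z < 1 \<Longrightarrow> cmod (g z) \<le> 1"
  shows "cmod ((deriv ^^ M) g 0) \<le> fact M"
proof (rule tendsto_le[OF sequentially_bot])
  define \<rho> where "\<rho> k = 1 - 1 / real (k + 2)" for k
  have \<rho>: "\<rho> k > 0" "\<rho> k < 1" for k by (auto simp: \<rho>_def)
  have lim: "\<rho> \<longlonglongrightarrow> 1" unfolding \<rho>_def by real_asymp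
  show "(\<lambda>k. fact M * 1 / \<rho> k ^ M) \<longlonglongrightarrow> fact M"
    by (auto intro!: tendsto_eq_intros lim)
  show "\<forall>\<^sub>F k in sequentially. cmod ((deriv ^^ M) g 0) \<le> fact M * 1 / \<rho> k ^ M"
  proof (intro always_eventually allI Cauchy_inequality)
    fix k
    have sub: "ball 0 (\<rho> k) \<subseteq> ball (0::complex) 1" "cball 0 (\<rho> k) \<subseteq> ball (0::complex) 1" using \<rho>[of k] by auto
    show "g holomorphic_on ball 0 (\<rho> k)" using g sub holomorphic_on_subset by blast
    show "continuous_on (cball 0 (\<rho> k)) g"
      using g sub holomorphic_on_imp_continuous_on continuous_on_subset by blast
    show "cmod (g x) \<le> 1" if "cmod (0 - x) = \<rho> k" for x
      using le[of x] that \<rho>[of k] by simp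
  qed (use \<rho> in auto)
qed simp

text \<open>Cauchy's estimate on a small circle: the factor \<open>\<rho> ^ M\<close> cancels and
  leaves an arbitrarily small bound.\<close>

lemma higher_deriv_eq_0_little_o:
  assumes H: "H holomorphic_on ball 0 r" and r: "r > 0"
    and o: "\<And>\<epsilon>. \<epsilon> > 0 \<Longrightarrow> \<exists>\<delta>>0. \<forall>z. cmod z < \<delta> \<longrightarrow> cmod (H z) \<le> \<epsilon> * cmod z ^ M"
  shows "(deriv ^^ M) H 0 = 0"
proof -
  have "cmod ((deriv ^^ M) H 0) \<le> 0 + e" if e: "e > 0" for e
  proof -
    obtain \<delta> where \<delta>: "\<delta> > 0" "\<And>z. cmod z < \<delta> \<Longrightarrow> cmod (H z) \<le> e / fact M * cmod z ^ M"
      using o[of "e / fact M"] e by auto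
    define \<rho> where "\<rho> = min \<delta> r / 2"
    have \<rho>: "\<rho> > 0" "\<rho> < \<delta>" "\<rho> < r" using \<delta>(1) r by (auto simp: \<rho>_def)
    have sub: "ball 0 \<rho> \<subseteq> ball (0::complex) r" "cball 0 \<rho> \<subseteq> ball (0::complex) r" using \<rho> by auto
    have "cmod ((deriv ^^ M) H 0) \<le> fact M * (e / fact M * \<rho> ^ M) / \<rho> ^ M"
    proof (rule Cauchy_inequality)
      show "H holomorphic_on ball 0 \<rho>" using H sub holomorphic_on_subset by blast
      show "continuous_on (cball 0 \<rho>) H"
        using H sub holomorphic_on_imp_continuous_on continuous_on_subset by blast
      show "cmod (H x) \<le> e / fact M * \<rho> ^ M" if "cmod (0 - x) = \<rho>" for x
        using \<delta>(2)[of x] that \<rho> by simp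
    qed (use \<rho> in auto)
    thus ?thesis using \<rho> by simp
  qed
  hence "cmod ((deriv ^^ M) H 0) \<le> 0" by (rule field_le_epsilon)
  thus ?thesis by simp
qed

text \<open>Cauchy's estimate along complex lines, applied to the remainder of the first-order
  expansion at \<open>z\<close>, shows that the derivatives at nearby points are close to
  \<open>L\<close>; the mean value inequality then compares two arbitrary nearby points. This serves
  to compare \<open>f\<close> on two curves that are much closer to each other than to the
  origin.\<close>

lemma holo_on_strict_differentiable:
  fixes f :: "complex^'n::finite \<Rightarrow> complex"
  assumes f: "holo_on D f" and r: "r > 0" "ball z r \<subseteq> D" and L: "(f has_derivative L) (at z)" and e: "\<epsilon> > 0"
  shows "\<exists>\<delta>>0. \<forall>x\<in>ball z \<delta>. \<forall>y\<in>ball z \<delta>. cmod (f x - f y - L (x - y)) \<le> \<epsilon> * norm (x - y)"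
proof -
  have zD: "z \<in> D" using r by auto
  have Ls: "L (c *s v) = c * L v" for c v using holo_on_deriv[OF f zD L] .
  have Lb: "bounded_linear L" using L has_derivative_bounded_linear by blast
  obtain d where d: "d > 0" "\<And>y. norm (y - z) < d \<Longrightarrow> cmod (f y - f z - L (y - z)) \<le> \<epsilon> / 4 * norm (y - z)"
  proof -
    have "\<epsilon> / 4 > 0" using e by simp
    from L[unfolded has_derivative_at_alt, THEN conjunct2, rule_format, OF this]
    show ?thesis using that by blast
  qed
  define d0 where "d0 = min d r"
  have d0: "d0 > 0" "d0 \<le> d" "d0 \<le> r" using d r by (auto simp: d0_def)
  have der: "onorm (\<lambda>v. L' v - L v) \<le> \<epsilon>"
    if p: "norm (p - z) < d0 / 2" and L': "(f has_derivative L') (at p)" for p L'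
  proof (rule onorm_le)
    fix v
    show "norm (L' v - L v) \<le> \<epsilon> * norm v"
    proof (cases "v = 0")
      case True
      have "L' 0 = 0" using linear_simps(3)[OF has_derivative_bounded_linear[OF L']] .
      moreover have "L 0 = 0" using linear_simps(3)[OF Lb] .
      ultimately show ?thesis using True by simp
    next
      case False
      \<comment> \<open>With this radius the disc stays within \<open>d0 / 2 + d0 / 3\<close> of
        \<open>z\<close>, and the Cauchy bound \<open>\<epsilon> / 4 * d0 / \<rho>\<close> is
        \<open>3 / 4 * \<epsilon> * norm v\<close>.\<close>
      define \<rho> where "\<rho> = d0 / (3 * norm v)"
      have \<rho>: "\<rho> > 0" using d0 False by (simp add: \<rho>_def)
      have near: "norm (p + \<eta> *s v - z) < d0" if "cmod \<eta> \<le> \<rho>" for \<eta>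
      proof -
        have "norm (\<eta> *s v) \<le> \<rho> * norm v" unfolding norm_cvec_scale using that by (intro mult_right_mono) auto
        also have "\<dots> = d0 / 3" using False by (simp add: \<rho>_def)
        finally have "norm (p - z) + norm (\<eta> *s v) < d0" using p d0 by linarith
        moreover have "norm ((p - z) + \<eta> *s v) \<le> norm (p - z) + norm (\<eta> *s v)" by (rule norm_triangle_ineq)
        ultimately show ?thesis by (simp add: algebra_simps)
      qed
      have inD: "p + \<eta> *s v \<in> D" if "cmod \<eta> \<le> \<rho>" for \<eta>
        using near[OF that] r d0 by (auto simp: subset_iff dist_norm norm_minus_commute)
      define h where "h \<eta> = f (p + \<eta> *s v) - f z - L (p + \<eta> *s v - z)" for \<eta>
      have Leq: "L (p + \<eta> *s v - z) = L (p - z) + \<eta> * L v" for \<eta>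
        using linear_simps(1)[OF Lb, of "p - z" "\<eta> *s v"] Ls by (simp add: algebra_simps)
      have dv: "((\<lambda>\<eta>. p + \<eta> *s v) has_derivative (\<lambda>h. h *s v)) (at \<eta>)" for \<eta>
        using has_derivative_add[OF has_derivative_const has_derivative_scale_left[OF DERIV_ident], of p v] by simp
      have hol: "h holomorphic_on cball 0 \<rho>"
        unfolding h_def Leq
        by (intro holomorphic_on_diff holomorphic_on_add holomorphic_on_mult holomorphic_on_const holomorphic_on_ident holomorphic_on_comp_vec[OF f]) (use inD in simp, rule exI[of _ v], rule dv)
      have "cmod ((deriv ^^ 1) h 0) \<le> fact 1 * (\<epsilon> / 4 * d0) / \<rho> ^ 1"
      proof (rule Cauchy_inequality)
        show "h holomorphic_on ball 0 \<rho>" using hol holomorphic_on_subset by (metis ball_subset_cball)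
        show "continuous_on (cball 0 \<rho>) h" using hol holomorphic_on_imp_continuous_on by blast
        show "cmod (h x) \<le> \<epsilon> / 4 * d0" if "cmod (0 - x) = \<rho>" for x
        proof -
          have "cmod x \<le> \<rho>" using that by simp
          have n: "norm (p + x *s v - z) < d0" by (rule near) fact
          have "cmod (h x) \<le> \<epsilon> / 4 * norm (p + x *s v - z)"
            unfolding h_def using n d0 by (intro d(2)) auto
          also have "\<dots> \<le> \<epsilon> / 4 * d0" using n e by (intro mult_left_mono) auto
          finally show ?thesis .
        qed
      qed (fact \<rho>)
      moreover have "(h has_field_derivative L' v - L v) (at 0)"
      proof -
        have "p \<in> D" using inD[of 0] \<rho> by simp
        hence Ls': "L' (c *s v) = c * L' v" for c v by (rule holo_on_deriv[OF f _ L'])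
        have 1: "((\<lambda>\<eta>. f (p + \<eta> *s v)) has_field_derivative L' v) (at 0)"
          by (rule has_field_derivative_comp_vec[OF dv _ Ls']) (use L' in simp)
        have 2: "((\<lambda>\<eta>. L (p - z) + \<eta> * L v) has_field_derivative L v) (at 0)"
          by (auto intro!: derivative_eq_intros)
        show ?thesis unfolding h_def Leq
          using DERIV_diff[OF DERIV_diff[OF 1 DERIV_const] 2] by simp
      qed
      ultimately have "cmod (L' v - L v) \<le> \<epsilon> / 4 * d0 / \<rho>"
        by (simp add: DERIV_imp_deriv)
      also have "\<dots> = 3 / 4 * \<epsilon> * norm v" using False d0 by (simp add: \<rho>_def)
      also have "\<dots> \<le> \<epsilon> * norm v" using e by (intro mult_right_mono) auto
      finally show ?thesis .
    qed
  qed
  have "cmod (f x - f y - L (x - y)) \<le> \<epsilon> * norm (x - y)" if xy: "x \<in> ball z (d0/2)" "y \<in> ball z (d0/2)" for x y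
  proof -
    have "\<exists>L'. (f has_derivative L') (at p)" if "p \<in> ball z (d0/2)" for p
    proof -
      have "p \<in> ball z r" using that d0 by auto
      thus ?thesis using f r(2) unfolding holo_on_def by blast
    qed
    then obtain f' where f': "\<And>p. p \<in> ball z (d0/2) \<Longrightarrow> (f has_derivative f' p) (at p)" by metis
    have "norm ((f x - L x) - (f y - L y)) \<le> \<epsilon> * norm (x - y)"
    proof (rule differentiable_bound[where S = "ball z (d0/2)" and f' = "\<lambda>p v. f' p v - L v"])
      fix p assume p: "p \<in> ball z (d0/2)"
      show "((\<lambda>x. f x - L x) has_derivative (\<lambda>v. f' p v - L v)) (at p within ball z (d0/2))"
        using f'[OF p] bounded_linear_imp_has_derivative[OF Lb]
        by (intro has_derivative_at_withinI[OF has_derivative_diff])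
      show "onorm (\<lambda>v. f' p v - L v) \<le> \<epsilon>"
        using p by (intro der[OF _ f'[OF p]]) (auto simp: dist_norm norm_minus_commute)
    qed (use xy in auto)
    moreover have "f x - f y - L (x - y) = (f x - L x) - (f y - L y)"
      unfolding linear_simps(2)[OF Lb, of x y] by simp
    ultimately show ?thesis by (simp only:)
  qed
  thus ?thesis using d0(1) by (intro exI[of _ "d0/2"]) auto
qed

section \<open>The symmetrized polydisc\<close>

locale coordinate_labelling =
  fixes \<sigma> :: "'n::finite \<Rightarrow> nat"
  assumes bij: "bij_betw \<sigma> UNIV {1..CARD('n)}"
begin

lemma \<sigma>_range: "\<sigma> k \<ge> 1" "\<sigma> k \<le> CARD('n)"
  using bij by (auto simp: bij_betw_def)

lemma \<sigma>_inj: "\<sigma> j = \<sigma> k \<longleftrightarrow> j = k"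
  using bij by (auto simp: bij_betw_def inj_def)

lemma \<sigma>_surj: "1 \<le> j \<Longrightarrow> j \<le> CARD('n) \<Longrightarrow> \<exists>k. \<sigma> k = j"
  using bij_betw_imp_surj_on[OF bij] by (metis UNIV_I atLeastAtMost_iff image_iff)

lemma symm_polydiskI_roots:
  assumes "e 0 = 1"
    and "\<And>z. (\<Sum>j\<le>CARD('n). (-1) ^ j * e j * z ^ (CARD('n) - j)) = 0 \<Longrightarrow> cmod z < 1"
    and "\<And>k. x $ k = e (\<sigma> k)"
  shows "x \<in> symm_polydisk \<sigma>"
proof -
  obtain l :: "complex^'n" where "\<And>i. cmod (l $ i) < 1" "\<And>j. j \<le> CARD('n) \<Longrightarrow> esym j l = e j"
    using ex_esym_eq[where 'n = 'n, of e "\<lambda>z. cmod z < 1"] assms(1,2) by blast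
  hence "(\<forall>i. cmod (l $ i) < 1) \<and> (\<forall>k. x $ k = esym (\<sigma> k) l)"
    using assms(3) \<sigma>_range by simp
  thus ?thesis unfolding symm_polydisk_def by blast
qed

text \<open>A root with \<open>|z| \<ge> 1\<close> would give
  \<open>|z| ^ n \<le> n * norm x * |z| ^ n < |z| ^ n\<close>.\<close>

lemma ball_subset_symm_polydisk: "ball 0 (1 / CARD('n)) \<subseteq> symm_polydisk \<sigma>"
proof
  let ?n = "CARD('n)"
  have n: "?n > 0" by simp
  fix x :: "complex^'n" assume "x \<in> ball 0 (1 / ?n)"
  hence x: "norm x < 1 / ?n" by simp
  define e where "e j = (if j = 0 then 1 else x $ inv \<sigma> j)" for j
  have e_le: "cmod (e j) \<le> norm x" if "j > 0" for j
    using that Finite_Cartesian_Product.norm_nth_le[of x] by (simp add: e_def)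
  show "x \<in> symm_polydisk \<sigma>"
  proof (rule symm_polydiskI_roots[of e])
    fix z assume 0: "(\<Sum>j\<le>?n. (-1) ^ j * e j * z ^ (?n - j)) = 0"
    show "cmod z < 1"
    proof (rule ccontr)
      assume "\<not> cmod z < 1"
      hence z: "cmod z \<ge> 1" by simp
      have "(\<Sum>j\<le>?n. (-1) ^ j * e j * z ^ (?n - j)) = z ^ ?n + (\<Sum>j\<in>{1..?n}. (-1) ^ j * e j * z ^ (?n - j))"
      proof -
        have "{..?n} = insert 0 {1..?n}" by auto
        thus ?thesis by (simp add: e_def)
      qed
      hence "cmod z ^ ?n = cmod (\<Sum>j\<in>{1..?n}. (-1) ^ j * e j * z ^ (?n - j))"
        using 0 by (metis add_eq_0_iff norm_minus_cancel norm_power)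
      also have "\<dots> \<le> (\<Sum>j\<in>{1..?n}. norm x * cmod z ^ ?n)"
      proof (rule sum_norm_le)
        fix j assume j: "j \<in> {1..?n}"
        have "cmod z ^ (?n - j) \<le> cmod z ^ ?n" using z by (intro power_increasing) auto
        thus "cmod ((-1) ^ j * e j * z ^ (?n - j)) \<le> norm x * cmod z ^ ?n"
          using e_le[of j] j by (auto simp: norm_mult norm_power intro!: mult_mono)
      qed
      also have "\<dots> = (?n * norm x) * cmod z ^ ?n" by simp
      also have "\<dots> < 1 * cmod z ^ ?n"
      proof (rule mult_strict_right_mono)
        show "0 < cmod z ^ ?n" using z by (intro zero_less_power) linarith
      qed (use x n in \<open>simp add: field_simps\<close>)
      finally show False by simp
    qed
  next
    show "x $ k = e (\<sigma> k)" for k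
      using \<sigma>_range[of k] \<sigma>_inj by (simp add: e_def inv_f_f inj_def)
  qed (simp add: e_def)
qed

lemma zero_in_symm_polydisk: "0 \<in> symm_polydisk \<sigma>"
  using ball_subset_symm_polydisk by auto

text \<open>By homogeneity this is the image of \<open>z *s l\<close>; thus roots \<open>l\<close>
  on the unit circle, too, give curves inside the domain.\<close>

lemma symm_polydisk_weighted_scale:
  fixes l :: "complex^'n"
  assumes "\<And>i. cmod (l $ i) \<le> 1" "cmod z < 1"
  shows "(\<chi> k. z ^ \<sigma> k * esym (\<sigma> k) l) \<in> symm_polydisk \<sigma>"
proof -
  have "cmod ((z *s l) $ i) < 1" for i
    using assms(1)[of i] assms(2) mult_left_le[of "cmod (l $ i)" "cmod z"] by (simp add: norm_mult)
  moreover have "(\<chi> k. z ^ \<sigma> k * esym (\<sigma> k) l) $ k = esym (\<sigma> k) (z *s l)" for k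
    by (simp add: esym_scale)
  ultimately show ?thesis unfolding symm_polydisk_def
    by (intro CollectI exI[of _ "z *s l"] conjI allI)
qed

text \<open>Along the curve \<open>z \<mapsto> (z\<^sup>j e\<^sub>j)\<close> only the monomials of weight \<open>n - 1\<close> contribute to the
  \<open>(n - 1)\<close>-st Taylor coefficient; if the coordinates other than \<open>1, n - 1, n\<close> vanish, these are
  \<open>e\<^bsub>n-1\<^esub>\<close> and \<open>e\<^sub>1\<^bsup>n-1\<^esup>\<close>.\<close>

lemma weighted_coefficient_bound:
  fixes l :: "complex^'n"
  assumes n: "CARD('n) \<ge> 3" and k: "\<sigma> k1 = 1" "\<sigma> k0 = CARD('n) - 1"
    and f: "f \<in> holo_to_disc (symm_polydisk \<sigma>)" and L: "(f has_derivative L) (at 0)"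
    and l: "\<And>i. cmod (l $ i) \<le> 1" "\<And>j. 1 < j \<Longrightarrow> j < CARD('n) - 1 \<Longrightarrow> esym j l = 0"
  shows "cmod (L (axis k0 1) * esym (CARD('n) - 1) l
    + (deriv ^^ (CARD('n) - 1)) (\<lambda>z. f (z *s axis k1 1)) 0 / fact (CARD('n) - 1) * esym 1 l ^ (CARD('n) - 1)) \<le> 1"
proof -
  let ?n = "CARD('n)" and ?D = "symm_polydisk \<sigma>"
  define M where "M = ?n - 1"
  have M: "M \<ge> 2" "?n = Suc M" using n by (auto simp: M_def)
  have l2: "esym j l = 0" if "1 < j" "j < M" for j using l(2) that by (simp add: M_def)
  have k0: "\<sigma> k0 = M" using k(2) by (simp add: M_def)
  obtain kn where kn: "\<sigma> kn = ?n" using \<sigma>_surj[of ?n] n by auto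
  define x y u where "x = esym 1 l" and "y = esym M l" and "u = esym ?n l"
  define A B C where "A = axis k1 (1::complex)" and "B = axis k0 (1::complex)" and "C = axis kn (1::complex)"
  define a where "a = L B"
  have fh: "holo_on ?D f" and f1: "\<And>x. x \<in> ?D \<Longrightarrow> cmod (f x) < 1"
    using f by (auto simp: holo_to_disc_def image_subset_iff)
  have Ls: "L (c *s v) = c * L v" for c v using holo_on_deriv[OF fh zero_in_symm_polydisk L] .
  have Lb: "bounded_linear L" using L has_derivative_bounded_linear by blast
  define \<gamma> where "\<gamma> z = (z * x) *s A + (z ^ M * y) *s B + (z ^ ?n * u) *s C" for z
  have \<gamma>_eq: "\<gamma> z = (\<chi> k. z ^ \<sigma> k * esym (\<sigma> k) l)" for z
  proof (rule vec_eq_iff[THEN iffD2], rule allI)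
    fix k
    have k': "k = k1 \<longleftrightarrow> \<sigma> k = 1" "k = k0 \<longleftrightarrow> \<sigma> k = M" "k = kn \<longleftrightarrow> \<sigma> k = ?n"
      using \<sigma>_inj[of k k1] \<sigma>_inj[of k k0] \<sigma>_inj[of k kn] k(1) k0 kn by simp_all
    have "\<sigma> k = 1 \<or> (1 < \<sigma> k \<and> \<sigma> k < M) \<or> \<sigma> k = M \<or> \<sigma> k = ?n"
      using \<sigma>_range[of k] M(2) by linarith
    thus "\<gamma> z $ k = (\<chi> k. z ^ \<sigma> k * esym (\<sigma> k) l) $ k"
      using M(1) l2[of "\<sigma> k"] unfolding \<gamma>_def A_def B_def C_def
      by (auto simp: axis_def k' x_def y_def u_def M(2))
  qed
  have \<gamma>D: "\<gamma> z \<in> ?D" if "cmod z < 1" for z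
    unfolding \<gamma>_eq using symm_polydisk_weighted_scale[OF l(1) that] .
  have d\<gamma>: "\<exists>v. (\<gamma> has_derivative (\<lambda>h. h *s v)) (at z)" for z
  proof -
    have "(\<gamma> has_derivative (\<lambda>h. h *s (x *s A) + h *s ((of_nat M * z ^ (M - 1) * y) *s B) + h *s ((of_nat ?n * z ^ (?n - 1) * u) *s C))) (at z)"
      unfolding \<gamma>_def
    proof (rule has_derivative_add[OF has_derivative_add[OF has_derivative_scale_left has_derivative_scale_left] has_derivative_scale_left])
    qed (auto intro!: derivative_eq_intros)
    thus ?thesis by (intro exI[of _ "x *s A + (of_nat M * z ^ (M - 1) * y) *s B + (of_nat ?n * z ^ (?n - 1) * u) *s C"])
      (simp only: vector_add_ldistrib)
  qed
  have g: "(\<lambda>z. f (\<gamma> z)) holomorphic_on ball 0 1"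
    by (rule holomorphic_on_comp_vec[OF fh]) (use \<gamma>D d\<gamma> in auto)
  define r where "r = 1 / real ?n"
  have r: "r > 0" "r \<le> 1" "ball 0 r \<subseteq> ?D" using ball_subset_symm_polydisk by (auto simp: r_def)
  have nA: "norm A = 1" "norm B = 1" "norm C = 1"
    by (simp_all add: A_def B_def C_def norm_eq_1 inner_axis_axis inner_complex_def)
  have dA: "\<exists>v. ((\<lambda>z. z *s A) has_derivative (\<lambda>h. h *s v)) (at z)" for z
    using has_derivative_scale_left[OF DERIV_ident] by blast
  have h0: "(\<lambda>z. f (z *s A)) holomorphic_on ball 0 r"
    by (rule holomorphic_on_comp_vec[OF fh _ dA]) (use r in \<open>auto simp: norm_cvec_scale nA\<close>)
  \<comment> \<open>A radius for which \<open>(x * z) *s A\<close> stays in a ball contained in the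
    domain; the summand 1 covers \<open>x = 0\<close>.\<close>
  define \<rho> where "\<rho> = r / (1 + cmod x)"
  have x1: "1 + cmod x > 0" by (smt (verit) norm_ge_zero)
  have \<rho>: "\<rho> > 0" "\<rho> \<le> r" using r x1 by (auto simp: \<rho>_def field_simps)
  have zx: "cmod (x * z) < r" if "cmod z < \<rho>" for z
  proof -
    have "cmod (x * z) \<le> (1 + cmod x) * cmod z" unfolding norm_mult by (intro mult_right_mono) auto
    also have "\<dots> < (1 + cmod x) * \<rho>" using that x1 by (intro mult_strict_left_mono)
    also have "\<dots> = r" using x1 by (simp add: \<rho>_def)
    finally show ?thesis .
  qed
  have h1: "(\<lambda>z. f ((x * z) *s A)) holomorphic_on ball 0 \<rho>"
    using holomorphic_on_compose_gen[OF _ h0, of "\<lambda>z. x * z" "ball 0 \<rho>"] zx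
    by (force simp: o_def intro!: holomorphic_intros)
  have g': "(\<lambda>z. f (\<gamma> z)) holomorphic_on ball 0 \<rho>"
    using g by (rule holomorphic_on_subset) (use \<rho> r in auto)
  \<comment> \<open>\<open>H\<close> removes from \<open>f\<close> along the curve the part along
    the first axis and the linear contribution of \<open>s_M\<close>. What remains is
    \<open>o(|z| ^ M)\<close>, so it has no coefficient of order \<open>M\<close>.\<close>
  define H where "H z = f (\<gamma> z) - f ((x * z) *s A) - a * y * z ^ M" for z
  have "(deriv ^^ M) H 0 = 0"
  proof (rule higher_deriv_eq_0_little_o)
    show "H holomorphic_on ball 0 \<rho>" unfolding H_def by (intro holomorphic_intros g' h1)
    show "\<rho> > 0" by fact
    fix \<epsilon> :: real assume e: "\<epsilon> > 0"
    define K where "K = cmod y + cmod u + cmod (u * L C) + 1"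
    have K: "K > 0" "cmod y + cmod u \<le> K" "cmod (u * L C) \<le> K" unfolding K_def by (auto simp: add_nonneg_pos)
    obtain \<delta> where \<delta>: "\<delta> > 0" "\<And>p q. p \<in> ball 0 \<delta> \<Longrightarrow> q \<in> ball 0 \<delta> \<Longrightarrow> cmod (f p - f q - L (p - q)) \<le> \<epsilon> / (2 * K) * norm (p - q)"
      using holo_on_strict_differentiable[OF fh r(1,3) L, of "\<epsilon> / (2 * K)"] e K(1) by auto
    have "\<forall>\<^sub>F z in nhds 0. \<gamma> z \<in> ball 0 \<delta> \<and> (x * z) *s A \<in> ball 0 \<delta> \<and> cmod z < min 1 (\<epsilon> / (2 * K))"
    proof (intro eventually_conj)
      have "isCont \<gamma> 0" using d\<gamma>[of 0] has_derivative_continuous by blast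
      moreover have "\<gamma> 0 = 0" using M by (simp add: \<gamma>_def)
      ultimately have "(\<gamma> \<longlongrightarrow> 0) (nhds 0)" by (simp add: tendsto_nhds_iff isCont_def)
      thus "\<forall>\<^sub>F z in nhds 0. \<gamma> z \<in> ball 0 \<delta>" by (rule topological_tendstoD) (use \<delta> in auto)
      have "((\<lambda>z. cmod (x * z)) \<longlongrightarrow> cmod (x * 0)) (nhds 0)"
        by (intro tendsto_norm tendsto_mult tendsto_const filterlim_ident)
      hence "\<forall>\<^sub>F z in nhds 0. cmod (x * z) < \<delta>" by (rule order_tendstoD) (use \<delta> in auto)
      thus "\<forall>\<^sub>F z in nhds 0. (x * z) *s A \<in> ball 0 \<delta>"
        by eventually_elim (simp add: norm_cvec_scale nA norm_mult)
      have "((\<lambda>z. cmod z) \<longlongrightarrow> cmod (0::complex)) (nhds 0)"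
        by (intro tendsto_norm filterlim_ident)
      thus "\<forall>\<^sub>F z in nhds 0. cmod (z::complex) < min 1 (\<epsilon> / (2 * K))"
        by (rule order_tendstoD) (use e K in auto)
    qed
    then obtain d where d: "d > 0" "\<And>z. cmod z < d \<Longrightarrow> \<gamma> z \<in> ball 0 \<delta> \<and> (x * z) *s A \<in> ball 0 \<delta> \<and> cmod z < min 1 (\<epsilon> / (2 * K))"
      unfolding eventually_nhds_metric by (auto simp: dist_norm)
    show "\<exists>d>0. \<forall>z. cmod z < d \<longrightarrow> cmod (H z) \<le> \<epsilon> * cmod z ^ M"
    proof (intro exI[of _ d] conjI allI impI)
      fix z assume "cmod z < d"
      note z = d(2)[OF this]
      \<comment> \<open>The two curves differ by exactly \<open>z ^ M *s w\<close> with
        \<open>w\<close> bounded. Strict differentiability gives an error \<open>o(|z| ^ M)\<close>,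
        and \<open>L\<close> contributes \<open>z ^ M * y * a\<close> plus a term of order
        \<open>M + 1\<close>.\<close>
      define w where "w = y *s B + (z * u) *s C"
      have diff: "\<gamma> z - (x * z) *s A = z ^ M *s w"
        by (simp add: \<gamma>_def w_def M(2) vec_eq_iff algebra_simps)
      have Lw: "L (z ^ M *s w) = z ^ M * (y * a + z * (u * L C))"
      proof -
        have "L w = y * a + z * (u * L C)"
          using linear_simps(1)[OF Lb, of "y *s B" "(z * u) *s C"] by (simp add: Ls w_def a_def)
        thus ?thesis by (simp only: Ls)
      qed
      have nw: "norm w \<le> K"
      proof -
        have "norm w \<le> norm (y *s B) + norm ((z * u) *s C)" unfolding w_def by (rule norm_triangle_ineq)
        also have "\<dots> \<le> cmod y + 1 * cmod u"
        proof -
          have "cmod z * cmod u \<le> 1 * cmod u" using z by (intro mult_right_mono) auto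
          thus ?thesis by (simp add: norm_cvec_scale nA norm_mult)
        qed
        finally show ?thesis using K by simp
      qed
      have "H z = (f (\<gamma> z) - f ((x * z) *s A) - L (\<gamma> z - (x * z) *s A)) + z ^ M * (z * (u * L C))"
        unfolding diff Lw by (simp add: H_def algebra_simps)
      hence "cmod (H z) \<le> cmod (f (\<gamma> z) - f ((x * z) *s A) - L (\<gamma> z - (x * z) *s A)) + cmod (z ^ M * (z * (u * L C)))"
        by (metis norm_triangle_ineq)
      also have "\<dots> \<le> \<epsilon> / (2 * K) * norm (z ^ M *s w) + cmod z ^ M * (\<epsilon> / (2 * K) * K)"
      proof (rule add_mono)
        show "cmod (f (\<gamma> z) - f ((x * z) *s A) - L (\<gamma> z - (x * z) *s A)) \<le> \<epsilon> / (2 * K) * norm (z ^ M *s w)"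
          using \<delta>(2)[of "\<gamma> z" "(x * z) *s A"] z unfolding diff by blast
        show "cmod (z ^ M * (z * (u * L C))) \<le> cmod z ^ M * (\<epsilon> / (2 * K) * K)"
          unfolding norm_mult norm_power using z K e by (intro mult_left_mono mult_mono) (auto simp: norm_mult)
      qed
      also have "\<dots> \<le> \<epsilon> / (2 * K) * (cmod z ^ M * K) + cmod z ^ M * (\<epsilon> / (2 * K) * K)"
        unfolding norm_cvec_scale norm_power using nw e K
        by (intro add_mono mult_left_mono) auto
      also have "\<dots> = \<epsilon> * cmod z ^ M" using K by (simp add: field_simps)
      finally show "cmod (H z) \<le> \<epsilon> * cmod z ^ M" .
    qed (fact d(1))
  qed
  moreover have "(deriv ^^ M) H 0 = (deriv ^^ M) (\<lambda>z. f (\<gamma> z)) 0 - x ^ M * (deriv ^^ M) (\<lambda>z. f (z *s A)) 0 - a * y * fact M"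
  proof -
    have 0: "0 \<in> ball (0::complex) \<rho>" using \<rho> by simp
    have p: "(deriv ^^ M) (\<lambda>z. a * y * z ^ M) 0 = a * y * fact M"
    proof -
      have "(deriv ^^ M) (\<lambda>w. (w - 0) ^ M) (0::complex) = fact M"
        unfolding higher_deriv_power by (simp add: pochhammer_fact)
      thus ?thesis by (subst higher_deriv_cmult[of _ UNIV]) (auto intro!: holomorphic_intros)
    qed
    have q: "(deriv ^^ M) (\<lambda>z. f ((x * z) *s A)) 0 = x ^ M * (deriv ^^ M) (\<lambda>z. f (z *s A)) 0"
      using higher_deriv_compose_linear[OF h0, of "ball 0 \<rho>" 0 x M] zx \<rho> by auto
    have "(deriv ^^ M) H 0 = (deriv ^^ M) (\<lambda>z. f (\<gamma> z) - f ((x * z) *s A)) 0 - (deriv ^^ M) (\<lambda>z. a * y * z ^ M) 0"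
      unfolding H_def by (rule higher_deriv_diff[OF _ _ open_ball 0]) (intro holomorphic_intros g' h1)+
    also have "(deriv ^^ M) (\<lambda>z. f (\<gamma> z) - f ((x * z) *s A)) 0 = (deriv ^^ M) (\<lambda>z. f (\<gamma> z)) 0 - (deriv ^^ M) (\<lambda>z. f ((x * z) *s A)) 0"
      by (rule higher_deriv_diff[OF g' h1 open_ball 0])
    finally show ?thesis unfolding p q .
  qed
  ultimately have "(deriv ^^ M) (\<lambda>z. f (\<gamma> z)) 0 = fact M * (a * y + (deriv ^^ M) (\<lambda>z. f (z *s A)) 0 / fact M * x ^ M)"
    by (simp add: field_simps)
  hence "fact M * cmod (a * y + (deriv ^^ M) (\<lambda>z. f (z *s A)) 0 / fact M * x ^ M) = cmod ((deriv ^^ M) (\<lambda>z. f (\<gamma> z)) 0)"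
    by (simp add: norm_mult)
  also have "\<dots> \<le> fact M" by (rule higher_deriv_unit_disc_bound[OF g]) (use \<gamma>D f1 in \<open>auto intro: less_imp_le\<close>)
  finally have "cmod (a * y + (deriv ^^ M) (\<lambda>z. f (z *s A)) 0 / fact M * x ^ M) \<le> 1" by simp
  thus ?thesis unfolding a_def y_def x_def A_def B_def M_def .
qed

end

section \<open>An upper bound for the Caratheodory-Reiffen metric\<close>

lemma cos_le_quartic: "cos x \<le> 1 - x\<^sup>2 / 2 + x ^ 4 / (24::real)"
proof -
  obtain t where "cos x = (\<Sum>m<4. cos_coeff m * x ^ m) + (cos (t + 1/2 * real 4 * pi) / fact 4) * x ^ 4"
    using Maclaurin_cos_expansion[of x 4] by auto
  also have "(\<Sum>m<4. cos_coeff m * x ^ m) = 1 - x\<^sup>2 / 2"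
  proof -
    have "(\<Sum>m<4. f m) = f 0 + f 1 + f 2 + f 3" for f :: "nat \<Rightarrow> real"
      by (simp add: eval_nat_numeral)
    thus ?thesis by (simp add: cos_coeff_def fact_2)
  qed
  also have "(cos (t + 1/2 * real 4 * pi) / fact 4) * x ^ 4 \<le> (1 / 24) * x ^ 4"
    by (intro mult_right_mono) (auto simp: fact_numeral)
  finally show ?thesis by simp
qed

text \<open>The case \<open>M = 2\<close> is direct. Otherwise, with
  \<open>q = (pi / N)\<^sup>2\<close>, the quartic bound for the cosine reduces the claim to
  comparing \<open>3.6\<close> with
  \<open>((N - 1)\<^sup>2 + 3.6) * (q / 2 - q\<^sup>2 / 24)\<close>.\<close>

lemma cos_pi_div_Suc_bound:
  assumes M: "M \<ge> 2"
  shows "(1 + 3.6 / (real M)\<^sup>2) * cos (pi / real (Suc M)) < 1"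
proof (cases "M = 2")
  case True
  thus ?thesis by (simp add: cos_60 eval_nat_numeral)
next
  case False
  define N where "N = real (Suc M)"
  have N: "N \<ge> 4" "real M = N - 1" using M False by (auto simp: N_def)
  define p where "p = pi\<^sup>2"
  have p: "p \<ge> 9.8" "p \<le> 9.9"
  proof -
    have "3.14 * 3.14 \<le> pi * pi" using pi_approx by (intro mult_mono) auto
    moreover have "pi * pi \<le> 3.142 * 3.142" using pi_approx by (intro mult_mono) auto
    ultimately show "p \<ge> 9.8" "p \<le> 9.9" by (auto simp: p_def power2_eq_square)
  qed
  define q where "q = p / N\<^sup>2"
  have N2: "N\<^sup>2 \<ge> 16" using power_mono[OF N(1), of 2] by simp
  have q: "q \<ge> 0" "q \<le> 9.9 / 16"
    unfolding q_def using p N2 by (simp, intro frac_le) auto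
  have c: "cos (pi / N) \<le> 1 - q / 2 + q\<^sup>2 / 24"
    using cos_le_quartic[of "pi / N"] by (simp add: q_def p_def power_divide flip: power_mult)
  have s: "(N - 1)\<^sup>2 + 3.6 \<ge> 0.78 * N\<^sup>2"
  proof -
    \<comment> \<open>Completing the square in \<open>0.22 * N\<^sup>2 - 2 * N + 4.6\<close>, whose
      minimum is slightly positive.\<close>
    have "0 \<le> 0.22 * (N - 1 / 0.22)\<^sup>2" by simp
    also have "\<dots> \<le> (N - 1)\<^sup>2 + 3.6 - 0.78 * N\<^sup>2" by (simp add: power2_eq_square algebra_simps)
    finally show ?thesis by simp
  qed
  \<comment> \<open>The estimate at the extreme values \<open>p = 9.8\<close> and
    \<open>q = 9.9 / 16\<close>, which leaves little room.\<close>
  have "3.6 < (0.78 * p) * (1 / 2 * (1 - 9.9 / 16 / 12))" using p by simp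
  also have "\<dots> \<le> (0.78 * p) * (1 / 2 * (1 - q / 12))" using p q by (intro mult_left_mono) auto
  also have "\<dots> = (0.78 * N\<^sup>2) * (q / 2 - q\<^sup>2 / 24)"
    using N by (simp add: q_def field_simps power2_eq_square)
  also have "\<dots> \<le> ((N - 1)\<^sup>2 + 3.6) * (q / 2 - q\<^sup>2 / 24)"
  proof (rule mult_right_mono[OF s])
    have "q / 2 - q\<^sup>2 / 24 = q * (1 / 2 - q / 24)" by (simp add: power2_eq_square algebra_simps)
    also have "\<dots> \<ge> 0" using q by (intro mult_nonneg_nonneg) auto
    finally show "q / 2 - q\<^sup>2 / 24 \<ge> 0" .
  qed
  finally have "((N - 1)\<^sup>2 + 3.6) * (1 - q / 2 + q\<^sup>2 / 24) < (N - 1)\<^sup>2"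
    by (simp add: algebra_simps)
  moreover have "((N - 1)\<^sup>2 + 3.6) * cos (pi / N) \<le> ((N - 1)\<^sup>2 + 3.6) * (1 - q / 2 + q\<^sup>2 / 24)"
    using c by (intro mult_left_mono) auto
  ultimately have "((N - 1)\<^sup>2 + 3.6) * cos (pi / N) < (N - 1)\<^sup>2" by linarith
  moreover have "(N - 1)\<^sup>2 > 0" using N by simp
  ultimately have "(1 + 3.6 / (N - 1)\<^sup>2) * cos (pi / N) < 1"
    by (simp add: field_simps)
  thus ?thesis unfolding N(2)[symmetric] by (simp add: N_def)
qed

text \<open>The constant \<open>3.6\<close> is small enough for \<open>r < 1 / cos (\<pi> / (M + 1))\<close> for all \<open>M \<ge> 2\<close>, and large
  enough for the resulting bound to stay below the lower bounds for \<open>A\<close>.\<close>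

definition reiffen_bound :: "nat \<Rightarrow> real" where
  "reiffen_bound M = (let r = 1 + 3.6 / (real M)\<^sup>2 in (1 + r ^ M) / (r + r ^ M))"

lemma reiffen_bound_pos: "M > 0 \<Longrightarrow> reiffen_bound M > 0"
  unfolding reiffen_bound_def Let_def by (intro divide_pos_pos add_pos_pos zero_less_power) auto

text \<open>The number \<open>1 / 1.42\<close> is the coefficient of the quartic competitor on the
  axis when \<open>M = 2\<close>.\<close>

lemma reiffen_bound_2: "reiffen_bound 2 ^ 2 < 1 / 1.42"
  by (simp add: reiffen_bound_def power2_eq_square)

text \<open>The right-hand side is the coefficient of the power-sum competitor on the axis. The
  cases 3 and 4 are evaluated. For \<open>M \<ge> 5\<close> the bound equals
  \<open>1 - (r - 1) / (r + R)\<close> and is compared with an exponential: since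
  \<open>r + R < 3.6\<close>, its \<open>M\<close>-th power is below \<open>exp (- (1 / M))\<close>,
  which is at most \<open>M / (M + 1)\<close>.\<close>

lemma reiffen_bound_power:
  assumes M: "M \<ge> 3"
  shows "reiffen_bound M ^ M < real M / real (Suc M)"
proof -
  consider "M = 3" | "M = 4" | "M \<ge> 5" using M by linarith
  thus ?thesis
  proof cases
    case 3
    define r R where "r = 1 + 3.6 / (real M)\<^sup>2" and "R = r ^ M"
    have M0: "real M > 0" using 3 by simp
    have M2: "(real M)\<^sup>2 \<ge> 25" using power_mono[of 5 "real M" 2] 3 by simp
    have "3.6 / (real M)\<^sup>2 \<le> 3.6 / 25" using M2 by (intro frac_le) auto
    moreover have "3.6 / (real M)\<^sup>2 > 0" using M0 by (intro divide_pos_pos zero_less_power) auto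
    ultimately have r: "r > 1" "r \<le> 1.144" by (auto simp: r_def)
    have "R \<le> exp (3.6 / (real M)\<^sup>2) ^ M"
      unfolding R_def r_def by (intro power_mono exp_ge_add_one_self) (auto intro: add_nonneg_nonneg)
    also have "\<dots> = exp (3.6 / real M)"
      using M0 by (simp add: power2_eq_square flip: exp_of_nat_mult)
    \<comment> \<open>The exponent is at most \<open>0.72 = 8 * 0.09\<close>, and
      \<open>exp 0.09 \<le> 1 / 0.91\<close> then gives a rational bound.\<close>
    also have "\<dots> \<le> exp (real 8 * 0.09)" using 3 by (simp add: field_simps)
    also have "\<dots> = exp 0.09 ^ 8" by (rule exp_of_nat_mult)
    also have "\<dots> \<le> (1 / 0.91) ^ 8"
    proof (rule power_mono)
      have "1 + (- 0.09) \<le> exp (- 0.09 :: real)" by (rule exp_ge_add_one_self)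
      thus "exp 0.09 \<le> (1 / 0.91 :: real)" by (simp add: exp_minus field_simps)
    qed simp
    also have "\<dots> \<le> 2.2" by (simp add: eval_nat_numeral)
    finally have rR: "r + R < 3.6" "R \<ge> 1" using r by (auto simp: R_def)
    have "reiffen_bound M = (1 + R) / (r + R)"
      by (simp only: reiffen_bound_def Let_def r_def R_def)
    also have "\<dots> = 1 + - ((r - 1) / (r + R))"
      using r rR by (simp add: field_simps)
    also have "\<dots> \<le> exp (- ((r - 1) / (r + R)))" by (rule exp_ge_add_one_self)
    finally have "reiffen_bound M ^ M \<le> exp (- ((r - 1) / (r + R))) ^ M"
      using reiffen_bound_pos[of M] 3 by (intro power_mono) auto
    also have "\<dots> = exp (- ((3.6 / real M) / (r + R)))"
      using M0 by (simp add: r_def power2_eq_square flip: exp_of_nat_mult)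
    also have "\<dots> < exp (- (1 / real M))"
    proof -
      have "1 < 3.6 / (r + R)" using r rR by (subst less_divide_eq_1_pos) auto
      hence "1 / real M * 1 < 1 / real M * (3.6 / (r + R))"
        using M0 by (intro mult_strict_left_mono) auto
      also have "\<dots> = 3.6 / real M / (r + R)" by (simp add: mult_ac)
      finally show ?thesis by (simp only: exp_less_cancel_iff neg_less_iff_less mult_1_right)
    qed
    also have "\<dots> \<le> real M / real (Suc M)"
      using exp_ge_add_one_self[of "1 / real M"] M0 by (simp add: exp_minus field_simps)
    finally show ?thesis .
  qed (simp_all add: reiffen_bound_def eval_nat_numeral)
qed

text \<open>On the unit circle the polynomial is, up to the unimodular factor
  \<open>cis (n * \<phi>)\<close>, the real function \<open>2 * h \<phi>\<close>. This alternates in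
  sign at the points \<open>k * pi / n\<close>, which yields \<open>n\<close> distinct roots on the
  circle; a further root off the circle would exceed the degree.\<close>

lemma self_inversive_roots_on_circle:
  fixes X :: complex
  assumes n: "n \<ge> 3" and r: "r > 0" "r * cos (pi / real n) < 1" and X: "X = r * cis (pi + pi / real n)"
    and z: "z ^ n + X * z ^ (n - 1) + cnj X * z + 1 = 0"
  shows "cmod z = 1"
proof (rule ccontr)
  assume z1: "cmod z \<noteq> 1"
  define \<alpha> where "\<alpha> = pi + pi / real n"
  define p where "p = monom 1 n + monom X (n - 1) + monom (cnj X) 1 + 1"
  have pp: "poly p z = z ^ n + X * z ^ (n - 1) + cnj X * z + 1" for z
    by (simp add: p_def poly_monom)
  have p0: "p \<noteq> 0"
  proof
    assume "p = 0"
    moreover have "poly p 0 = 1" using n by (simp add: pp power_0_left)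
    ultimately show False by simp
  qed
  have dp: "degree p \<le> n"
    unfolding p_def using n by (intro degree_add_le order.trans[OF degree_monom_le]) auto
  define h where "h \<phi> = cos (real n * \<phi>) + r * cos ((real n - 2) * \<phi> + \<alpha>)" for \<phi>
  have ph: "poly p (cis (2 * \<phi>)) = cis (real n * \<phi>) * (2 * h \<phi>)" for \<phi>
  proof -
    define t where "t = (real n - 2) * \<phi> + \<alpha>"
    have c2: "2 * complex_of_real (cos x) = cis x + cis (- x)" for x
      by (simp add: complex_eq_iff)
    have "cis (2 * \<phi>) ^ n = cis (real n * \<phi>) * cis (real n * \<phi>)"
      by (simp only: Complex.DeMoivre cis_mult mult_2 distrib_left)
    moreover have "X * cis (2 * \<phi>) ^ (n - 1) = cis (real n * \<phi>) * (r * cis t)"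
      using n by (simp add: X Complex.DeMoivre cis_mult t_def \<alpha>_def algebra_simps of_nat_diff)
    moreover have "cnj X * cis (2 * \<phi>) = cis (real n * \<phi>) * (r * cis (- t))"
      by (simp add: X cis_mult cis_cnj t_def \<alpha>_def algebra_simps)
    moreover have "1 = cis (real n * \<phi>) * cis (- (real n * \<phi>))"
      by (simp add: cis_mult)
    ultimately have "poly p (cis (2 * \<phi>)) = cis (real n * \<phi>) * ((cis (real n * \<phi>) + cis (- (real n * \<phi>))) + r * (cis t + cis (- t)))"
      unfolding pp by (simp add: algebra_simps)
    also have "(cis (real n * \<phi>) + cis (- (real n * \<phi>))) + r * (cis t + cis (- t)) = 2 * h \<phi>"
      unfolding c2[symmetric] h_def t_def by (simp add: algebra_simps)
    finally show ?thesis .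
  qed
  have sign: "(-1) ^ k * h (real k * pi / n) > 0" if k: "k \<le> n" for k
  proof -
    have N: "real n > 0" using n by simp
    \<comment> \<open>The argument of \<open>X\<close> is chosen so that at
      \<open>k * pi / n\<close> the two terms of \<open>h\<close> combine to
      \<open>(-1) ^ k * (1 - r * cos \<theta>)\<close>. As an odd multiple of \<open>pi / n\<close>
      between \<open>- pi / n\<close> and \<open>2 * pi - pi / n\<close>, the angle
      \<open>\<theta>\<close> has cosine at most \<open>cos (pi / n)\<close>.\<close>
    define \<theta> where "\<theta> = (2 * real k - 1) * (pi / n)"
    have pn: "0 < pi / n" "pi / n \<le> pi" using n by (auto simp: field_simps)
    have "cos \<theta> \<le> cos (pi / n)"
    proof (cases "k = 0")
      case True
      thus ?thesis by (simp add: \<theta>_def)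
    next
      case False
      have lo: "\<theta> \<ge> pi / n" unfolding \<theta>_def using False pn mult_right_mono[of 1 "2 * real k - 1" "pi / n"] by simp
      have hi: "\<theta> \<le> 2 * pi - pi / n"
      proof -
        have "\<theta> \<le> (2 * real n - 1) * (pi / n)" unfolding \<theta>_def using k pn by (intro mult_right_mono) auto
        also have "\<dots> = 2 * pi - pi / n" using N by (simp add: field_simps)
        finally show ?thesis .
      qed
      show ?thesis
      proof (cases "\<theta> \<le> pi")
        case True
        thus ?thesis using lo pn by (intro cos_monotone_0_pi_le) auto
      next
        case False
        have "cos \<theta> = cos (2 * pi - \<theta>)" by (simp add: cos_diff)
        also have "\<dots> \<le> cos (pi / n)" using False hi pn by (intro cos_monotone_0_pi_le) auto
        finally show ?thesis .
      qed
    qed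
    hence "r * cos \<theta> \<le> r * cos (pi / n)" using r by (intro mult_left_mono) auto
    hence pos: "1 - r * cos \<theta> > 0" using r by linarith
    have e1: "real n * (real k * pi / n) = real k * pi" using N by simp
    have e2: "(real n - 2) * (real k * pi / n) + \<alpha> = real k * pi + (pi - \<theta>)"
      using N by (simp add: \<theta>_def \<alpha>_def field_simps)
    have e3: "cos (real k * pi + (pi - \<theta>)) = (-1) ^ k * - cos \<theta>"
      by (simp add: cos_add cos_diff)
    have "h (real k * pi / n) = (-1) ^ k * (1 - r * cos \<theta>)"
      unfolding h_def e1 e2 e3 by (simp add: algebra_simps)
    hence "(-1) ^ k * h (real k * pi / n) = ((-1) ^ k * (-1) ^ k) * (1 - r * cos \<theta>)" by simp
    thus ?thesis using pos by (simp flip: power_mult_distrib)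
  qed
  have "\<exists>\<psi>. real k * pi / n < \<psi> \<and> \<psi> < real (Suc k) * pi / n \<and> h \<psi> = 0" if k: "k < n" for k
  proof -
    define g where "g \<psi> = (-1) ^ k * h \<psi>" for \<psi>
    have g: "g (real k * pi / n) > 0" "g (real (Suc k) * pi / n) < 0"
      using sign[of k] sign[of "Suc k"] k by (auto simp: g_def)
    have le: "real k * pi / n \<le> real (Suc k) * pi / n" by (intro divide_right_mono mult_right_mono) auto
    have "continuous_on {real k * pi / n .. real (Suc k) * pi / n} g"
      unfolding g_def h_def by (intro continuous_intros)
    then obtain \<psi> where "\<psi> \<ge> real k * pi / n" "\<psi> \<le> real (Suc k) * pi / n" "g \<psi> = 0"
      using IVT2'[of g "real (Suc k) * pi / n" 0 "real k * pi / n"] g le by auto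
    moreover have "\<psi> \<noteq> real k * pi / n" "\<psi> \<noteq> real (Suc k) * pi / n" using g calculation by auto
    ultimately show ?thesis by (intro exI[of _ \<psi>]) (auto simp: g_def)
  qed
  then obtain \<psi> where \<psi>: "\<And>k. k < n \<Longrightarrow> real k * pi / n < \<psi> k \<and> \<psi> k < real (Suc k) * pi / n \<and> h (\<psi> k) = 0"
    by metis
  have mono: "\<psi> j < \<psi> k" if "j < k" "k < n" for j k
  proof -
    have "\<psi> j < real (Suc j) * pi / n" using \<psi>[of j] that by simp
    also have "\<dots> \<le> real k * pi / n" using that by (intro divide_right_mono mult_right_mono) auto
    also have "\<dots> < \<psi> k" using \<psi>[of k] that by simp
    finally show ?thesis .
  qed
  \<comment> \<open>The angles \<open>2 * \<psi> k\<close> lie in \<open>[0, 2 * pi)\<close>, so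
    distinct zeros of \<open>h\<close> give distinct points of the circle.\<close>
  have arg: "Arg2pi (cis (2 * \<psi> k)) = 2 * \<psi> k" if k: "k < n" for k
  proof (rule Arg2pi_unique[of 1])
    have "0 \<le> real k * pi / n" by simp
    thus "0 \<le> 2 * \<psi> k" using \<psi>[OF k] by linarith
    have "real (Suc k) * pi / n \<le> real n * pi / n" using k by (intro divide_right_mono mult_right_mono) auto
    thus "2 * \<psi> k < 2 * pi" using \<psi>[OF k] n by simp
  qed (simp_all add: cis_conv_exp)
  have inj: "inj_on (\<lambda>k. cis (2 * \<psi> k)) {..<n}"
  proof (rule inj_onI)
    fix j k assume jk: "j \<in> {..<n}" "k \<in> {..<n}" "cis (2 * \<psi> j) = cis (2 * \<psi> k)"
    have "2 * \<psi> j = Arg2pi (cis (2 * \<psi> j))" using arg[of j] jk(1) by simp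
    also have "\<dots> = 2 * \<psi> k" unfolding jk(3) using arg[of k] jk(2) by simp
    finally have "\<psi> j = \<psi> k" by simp
    thus "j = k" using mono[of j k] mono[of k j] jk(1,2) by (metis lessThan_iff less_irrefl nat_neq_iff)
  qed
  define S where "S = insert z ((\<lambda>k. cis (2 * \<psi> k)) ` {..<n})"
  have "card S = Suc n"
  proof -
    have "z \<notin> (\<lambda>k. cis (2 * \<psi> k)) ` {..<n}" using z1 by auto
    thus ?thesis unfolding S_def by (simp add: card_image[OF inj])
  qed
  moreover have "S \<subseteq> {x. poly p x = 0}"
  proof -
    have "poly p z = 0" unfolding pp by (rule z)
    moreover have "poly p (cis (2 * \<psi> k)) = 0" if "k < n" for k
      unfolding ph using \<psi>[OF that] by simp
    ultimately show ?thesis by (auto simp: S_def)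
  qed
  hence "card S \<le> card {x. poly p x = 0}" by (intro card_mono poly_roots_finite p0)
  moreover have "card {x. poly p x = 0} \<le> degree p" by (rule card_poly_roots_bound[OF p0])
  ultimately show False using dp by simp
qed

section \<open>Two inequalities between the Taylor coefficients \<open>a\<close> and
  \<open>b\<close>\<close>

lemma sum_weighted_support:
  fixes e :: "nat \<Rightarrow> complex"
  assumes M: "M \<ge> 2" and e: "e 0 = 1" "\<And>j. 1 < j \<Longrightarrow> j < M \<Longrightarrow> e j = 0"
  shows "(\<Sum>j\<le>Suc M. (-1) ^ j * e j * z ^ (Suc M - j))
    = z ^ Suc M - e 1 * z ^ M + (-1) ^ M * e M * z + (-1) ^ Suc M * e (Suc M)"
proof -
  have "(\<Sum>j\<le>Suc M. (-1) ^ j * e j * z ^ (Suc M - j)) = (\<Sum>j\<in>{0,1,M,Suc M}. (-1) ^ j * e j * z ^ (Suc M - j))"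
  proof (rule sum.mono_neutral_right)
    show "\<forall>i\<in>{..Suc M} - {0, 1, M, Suc M}. (-1) ^ i * e i * z ^ (Suc M - i) = 0"
    proof
      fix i assume "i \<in> {..Suc M} - {0, 1, M, Suc M}"
      hence "1 < i" "i < M" by auto
      thus "(-1) ^ i * e i * z ^ (Suc M - i) = 0" using e(2) by simp
    qed
  qed (use M in auto)
  also have "\<dots> = z ^ Suc M - e 1 * z ^ M + (-1) ^ M * e M * z + (-1) ^ Suc M * e (Suc M)"
    using M e(1) by simp
  finally show ?thesis .
qed

context coordinate_labelling
begin

text \<open>Test points are the roots of \<open>(z - 1) * (z ^ M + (-1) ^ M * y)\<close> with
  \<open>|y| = 1\<close>, for which \<open>s_1 = 1\<close> and \<open>s_M = y\<close>. A suitable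
  phase of \<open>y\<close> makes \<open>a * y\<close> and \<open>b\<close> point in the same
  direction.\<close>

lemma coefficients_sum_bound:
  assumes n: "CARD('n) = Suc M" "M \<ge> 2"
    and ab: "\<And>l :: complex^'n. (\<And>i. cmod (l $ i) \<le> 1) \<Longrightarrow> (\<And>j. 1 < j \<Longrightarrow> j < M \<Longrightarrow> esym j l = 0) \<Longrightarrow>
      cmod (a * esym M l + b * esym 1 l ^ M) \<le> 1"
  shows "cmod a + cmod b \<le> 1"
proof -
  have *: "cmod (a * y + b) \<le> 1" if y: "cmod y = 1" for y
  proof -
    define e where "e j = (if j = 0 \<or> j = 1 then 1 else if j = M \<or> j = Suc M then y else 0)" for j
    obtain l :: "complex^'n" where l: "\<And>i. cmod (l $ i) \<le> 1" "\<And>j. j \<le> CARD('n) \<Longrightarrow> esym j l = e j"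
    proof (rule ex_esym_eq[where 'n = 'n, of e "\<lambda>z. cmod z \<le> 1"])
      fix z assume "(\<Sum>j\<le>CARD('n). (-1) ^ j * e j * z ^ (CARD('n) - j)) = 0"
      hence "z ^ Suc M - z ^ M + (-1) ^ M * y * z + (-1) ^ Suc M * y = 0"
        unfolding n(1) using sum_weighted_support[OF n(2), of e z] n(2) by (simp add: e_def)
      hence "(z - 1) * (z ^ M + (-1) ^ M * y) = 0" by (simp add: algebra_simps)
      hence "z = 1 \<or> z ^ M = - ((-1) ^ M * y)" by (auto simp: add_eq_0_iff2)
      hence "z = 1 \<or> cmod z ^ M = 1"
        by (metis norm_minus_cancel norm_mult norm_one norm_power mult_1 power_one y)
      thus "cmod z \<le> 1" using n(2) by (metis norm_one order_refl power_eq_1_iff norm_ge_zero not_numeral_le_zero real_norm_def abs_of_nonneg)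
    qed (auto simp: e_def)
    have "esym M l = y" "esym 1 l = 1" "\<And>j. 1 < j \<Longrightarrow> j < M \<Longrightarrow> esym j l = 0"
      using l(2) n by (simp_all add: e_def)
    thus ?thesis using ab[OF l(1)] by simp
  qed
  show ?thesis
  proof (cases "a = 0 \<or> b = 0")
    case True
    thus ?thesis using *[of 1] by auto
  next
    case False
    define y where "y = b * cmod a / (a * cmod b)"
    have "cmod y = 1" using False by (simp add: y_def norm_divide norm_mult)
    moreover have "a * y + b = b * complex_of_real (cmod a / cmod b + 1)"
      using False by (simp add: y_def field_simps)
    moreover have "cmod (b * complex_of_real (cmod a / cmod b + 1)) = cmod a + cmod b"
    proof -
      have "cmod (complex_of_real (cmod a / cmod b + 1)) = cmod a / cmod b + 1"
        unfolding norm_of_real by (intro abs_of_nonneg add_nonneg_nonneg) auto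
      thus ?thesis unfolding norm_mult using False by (simp only:) (simp add: field_simps)
    qed
    ultimately show ?thesis using *[of y] by simp
  qed
qed

text \<open>The test point consists of the roots of the self-inversive polynomial, where both
  \<open>s_1\<close> and \<open>s_M\<close> have modulus \<open>r\<close>; the reverse triangle
  inequality separates the two terms.\<close>

lemma coefficients_diff_bound:
  assumes n: "CARD('n) = Suc M" "M \<ge> 2"
    and r: "r > 0" "r * cos (pi / real (Suc M)) < 1"
    and ab: "\<And>l :: complex^'n. (\<And>i. cmod (l $ i) \<le> 1) \<Longrightarrow> (\<And>j. 1 < j \<Longrightarrow> j < M \<Longrightarrow> esym j l = 0) \<Longrightarrow>
      cmod (a * esym M l + b * esym 1 l ^ M) \<le> 1"
  shows "cmod a * r - cmod b * r ^ M \<le> 1"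
proof -
  define X where "X = r * cis (pi + pi / real (Suc M))"
  have nX: "cmod X = r" using r by (simp add: X_def norm_mult)
  define e where "e j = (if j = 0 then 1 else if j = 1 then - X else if j = M then (-1) ^ M * cnj X
    else if j = Suc M then (-1) ^ Suc M else 0)" for j
  obtain l :: "complex^'n" where l: "\<And>i. cmod (l $ i) \<le> 1" "\<And>j. j \<le> CARD('n) \<Longrightarrow> esym j l = e j"
  proof (rule ex_esym_eq[where 'n = 'n, of e "\<lambda>z. cmod z \<le> 1"])
    fix z assume "(\<Sum>j\<le>CARD('n). (-1) ^ j * e j * z ^ (CARD('n) - j)) = 0"
    hence "z ^ Suc M - e 1 * z ^ M + (-1) ^ M * e M * z + (-1) ^ Suc M * e (Suc M) = 0"
      unfolding n(1) by (subst (asm) sum_weighted_support[OF n(2)]) (simp_all add: e_def)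
    moreover have "e 1 = - X" "e M = (-1) ^ M * cnj X" "e (Suc M) = (-1) ^ Suc M"
      using n(2) by (auto simp: e_def)
    moreover have "(-1) ^ M * ((-1) ^ M * cnj X) = cnj X" "(-1) ^ Suc M * (-1) ^ Suc M = (1::complex)"
      by (simp_all flip: power_mult_distrib mult.assoc)
    ultimately have "z ^ Suc M + X * z ^ (Suc M - 1) + cnj X * z + 1 = 0" by simp
    hence "cmod z = 1" by (intro self_inversive_roots_on_circle[OF _ r(1) _ X_def]) (use n r in auto)
    thus "cmod z \<le> 1" by simp
  qed (auto simp: e_def)
  have "esym M l = (-1) ^ M * cnj X" "esym 1 l = - X" "\<And>j. 1 < j \<Longrightarrow> j < M \<Longrightarrow> esym j l = 0"
    using l(2) n by (simp_all add: e_def)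
  hence "cmod (a * ((-1) ^ M * cnj X) + b * (- X) ^ M) \<le> 1" using ab[OF l(1)] by metis
  moreover have "cmod (a * ((-1) ^ M * cnj X)) - cmod (b * (- X) ^ M) \<le> cmod (a * ((-1) ^ M * cnj X) + b * (- X) ^ M)"
    by (rule norm_diff_ineq)
  ultimately show ?thesis by (simp add: norm_mult norm_power nX)
qed

text \<open>Eliminating \<open>cmod b\<close> from the two inequalities bounds \<open>cmod a\<close>
  alone.\<close>

lemma derivative_bound:
  assumes n: "CARD('n) = Suc M" "M \<ge> 2" and k0: "\<sigma> k0 = M"
    and f: "f \<in> holo_to_disc (symm_polydisk \<sigma>)" and L: "(f has_derivative L) (at 0)"
  shows "cmod (L (axis k0 1)) \<le> reiffen_bound M"
proof -
  define r where "r = 1 + 3.6 / (real M)\<^sup>2"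
  have r: "r > 0" "r * cos (pi / real (Suc M)) < 1"
    using cos_pi_div_Suc_bound[OF n(2)] by (auto simp: r_def intro: add_pos_nonneg)
  obtain k1 where k1: "\<sigma> k1 = 1" using \<sigma>_surj[of 1] n by auto
  define a where "a = L (axis k0 1)"
  define b where "b = (deriv ^^ M) (\<lambda>z. f (z *s axis k1 1)) 0 / fact M"
  have *: "cmod (a * esym M l + b * esym 1 l ^ M) \<le> 1"
    if "\<And>i. cmod (l $ i) \<le> 1" "\<And>j. 1 < j \<Longrightarrow> j < M \<Longrightarrow> esym j l = 0" for l :: "complex^'n"
    using weighted_coefficient_bound[OF _ k1 _ f L that(1), of k0] that(2) n k0
    by (simp add: a_def b_def)
  have "cmod a * r \<le> 1 + cmod b * r ^ M"
    using coefficients_diff_bound[OF n r *] by simp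
  also have "\<dots> \<le> 1 + (1 - cmod a) * r ^ M"
    using coefficients_sum_bound[OF n *] r by (intro add_mono mult_right_mono) auto
  finally have "cmod a * (r + r ^ M) \<le> 1 + r ^ M" by (simp add: algebra_simps)
  moreover have "r + r ^ M > 0" using r by (intro add_pos_pos zero_less_power)
  ultimately show ?thesis unfolding reiffen_bound_def Let_def a_def r_def by (simp add: pos_le_divide_eq)
qed

end

section \<open>Competitors for the Green function\<close>

lemma less_exp_ln_div:
  assumes "c > 0" "m > 0" "g ^ m < c"
  shows "g < exp (ln c / real m)"
proof (rule power_less_imp_less_base)
  have "exp (ln c / real m) ^ m = c" using assms by (simp flip: exp_of_nat_mult)
  thus "g ^ m < exp (ln c / real m) ^ m" using assms by simp
qed simp

lemma exp_ln_div_power: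
  assumes "c > 0" "m > 0" "t > 0"
  shows "exp (ln (c * t ^ m) / real m) = exp (ln c / real m) * t"
proof -
  have "ln (c * t ^ m) / real m = ln c / real m + ln t"
    using assms by (simp add: ln_mult ln_realpow field_simps)
  thus ?thesis using assms by (simp add: exp_add)
qed

section \<open>Power sums as polynomials: lines, order of vanishing, special values\<close>

lemma newton_psum_line:
  assumes "\<And>j. \<exists>q. \<forall>z. e z j = poly q z"
  shows "\<exists>q. \<forall>z. newton_psum (e z) N = poly q z"
proof (induction N rule: less_induct)
  case (less N)
  obtain q where q: "\<And>j z. e z j = poly (q j) z" using assms by metis
  have "\<exists>p. \<forall>j. j < N \<longrightarrow> (\<forall>z. newton_psum (e z) j = poly (p j) z)"
    using less.IH by metis
  then obtain p where p: "\<And>j z. j < N \<Longrightarrow> newton_psum (e z) j = poly (p j) z" by metis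
  have "newton_psum (e z) N = poly ([:(-1) ^ (N + 1) * of_nat N:] * q N + (\<Sum>j\<in>{1..<N}. [:(-1) ^ (j + 1):] * q j * p (N - j))) z" for z
    by (subst newton_psum.simps) (simp add: q p poly_sum mult.assoc)
  thus ?case by blast
qed

lemma newton_psum_continuous:
  assumes "\<And>j. continuous_on S (\<lambda>x. e x j)"
  shows "continuous_on S (\<lambda>x. newton_psum (e x) N)"
proof (induction N rule: less_induct)
  case (less N)
  show ?case
    by (subst newton_psum.simps) (intro continuous_intros assms less.IH, auto)
qed

text \<open>Giving \<open>e j\<close> the weight \<open>j \<le> n\<close>, the power sum has weight
  \<open>N\<close>, so for \<open>N > m * n\<close> each monomial contains at least
  \<open>m + 1\<close> factors. The induction splits off one factor \<open>e j\<close>, which lowers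
  the weight by at most \<open>n\<close>.\<close>

lemma newton_psum_order:
  fixes e :: "'a::real_normed_vector \<Rightarrow> nat \<Rightarrow> complex"
  assumes e: "\<And>x j. 1 \<le> j \<Longrightarrow> cmod (e x j) \<le> norm x" "\<And>x j. j > n \<Longrightarrow> e x j = 0"
  shows "m * n < N \<Longrightarrow> \<exists>K. \<forall>x. norm x \<le> 1 \<longrightarrow> cmod (newton_psum (e x) N) \<le> K * norm x ^ Suc m"
proof (induction N arbitrary: m rule: less_induct)
  case (less N)
  have "\<exists>K. \<forall>x. norm x \<le> 1 \<longrightarrow> cmod (e x j * newton_psum (e x) (N - j)) \<le> K * norm x ^ Suc m"
    if j: "j \<in> {1..<N}" for j
  proof (cases "j \<le> n")
    case False
    thus ?thesis using e(2) by (intro exI[of _ 0]) auto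
  next
    case True
    \<comment> \<open>For \<open>m = 0\<close> truncated subtraction keeps \<open>m - 1 = 0\<close>;
      the order then obtained for the product is one higher than required, which is harmless as
      \<open>norm x \<le> 1\<close>.\<close>
    have "(m - 1) * n < N - j"
    proof (cases m)
      case (Suc k)
      thus ?thesis using less.prems True by simp
    qed (use j in auto)
    then obtain K where K: "\<And>x. norm x \<le> 1 \<Longrightarrow> cmod (newton_psum (e x) (N - j)) \<le> K * norm x ^ Suc (m - 1)"
      using less.IH[of "N - j" "m - 1"] j by auto
    show ?thesis
    proof (intro exI[of _ "\<bar>K\<bar>"] allI impI)
      fix x :: 'a assume x: "norm x \<le> 1"
      have "cmod (e x j * newton_psum (e x) (N - j)) \<le> norm x * (\<bar>K\<bar> * norm x ^ Suc (m - 1))"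
        unfolding norm_mult
      proof (rule mult_mono)
        show "cmod (newton_psum (e x) (N - j)) \<le> \<bar>K\<bar> * norm x ^ Suc (m - 1)"
          using K[OF x] by (rule order.trans) (intro mult_right_mono, auto)
      qed (use e(1) j in auto)
      also have "\<dots> = \<bar>K\<bar> * norm x ^ Suc (Suc (m - 1))" by simp
      also have "\<dots> \<le> \<bar>K\<bar> * norm x ^ Suc m"
        using x by (intro mult_left_mono power_decreasing) auto
      finally show "cmod (e x j * newton_psum (e x) (N - j)) \<le> \<bar>K\<bar> * norm x ^ Suc m" .
    qed
  qed
  then obtain K where K: "\<And>j x. j \<in> {1..<N} \<Longrightarrow> norm x \<le> 1 \<Longrightarrow> cmod (e x j * newton_psum (e x) (N - j)) \<le> K j * norm x ^ Suc m"
    by metis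
  \<comment> \<open>For \<open>N \<le> n\<close> the hypothesis \<open>m * n < N\<close> forces
    \<open>m = 0\<close>; beyond \<open>n\<close> the term vanishes.\<close>
  have first: "cmod (e x N) \<le> norm x ^ Suc m" if x: "norm x \<le> 1" for x
  proof (cases "N \<le> n")
    case True
    have "m = 0"
    proof (rule ccontr)
      assume "m \<noteq> 0"
      hence "1 * n \<le> m * n" by (intro mult_le_mono1) simp
      hence "n \<le> m * n" by (simp only: mult_1)
      thus False using less.prems True by linarith
    qed
    thus ?thesis using e(1)[of N x] less.prems by simp
  qed (simp add: e(2))
  show ?case
  proof (intro exI[of _ "real N + (\<Sum>j\<in>{1..<N}. K j)"] allI impI)
    fix x :: 'a assume x: "norm x \<le> 1"
    have "cmod (newton_psum (e x) N) \<le> cmod ((-1) ^ (N + 1) * of_nat N * e x N) + cmod (\<Sum>j\<in>{1..<N}. (-1) ^ (j + 1) * e x j * newton_psum (e x) (N - j))"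
      by (subst newton_psum.simps) (rule norm_triangle_ineq)
    also have "\<dots> \<le> real N * norm x ^ Suc m + (\<Sum>j\<in>{1..<N}. K j * norm x ^ Suc m)"
    proof (rule add_mono)
      show "cmod ((-1) ^ (N + 1) * of_nat N * e x N) \<le> real N * norm x ^ Suc m"
        using mult_left_mono[OF first[OF x], of "real N"] by (simp add: norm_mult norm_power)
      show "cmod (\<Sum>j\<in>{1..<N}. (-1) ^ (j + 1) * e x j * newton_psum (e x) (N - j)) \<le> (\<Sum>j\<in>{1..<N}. K j * norm x ^ Suc m)"
        by (rule sum_norm_le) (use K x in \<open>auto simp: norm_mult norm_power\<close>)
    qed
    also have "\<dots> = (real N + (\<Sum>j\<in>{1..<N}. K j)) * norm x ^ Suc m"
      by (simp only: distrib_right sum_distrib_right)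
    finally show "cmod (newton_psum (e x) N) \<le> (real N + (\<Sum>j\<in>{1..<N}. K j)) * norm x ^ Suc m" .
  qed
qed

text \<open>With a single nonzero \<open>e M\<close> the recursion for \<open>N > M\<close> shrinks
  to one term, \<open>(-1) ^ (M + 1) * e M\<close> times the power sum of index
  \<open>N - M\<close>.\<close>

lemma newton_psum_single:
  assumes e: "\<And>j. 1 \<le> j \<Longrightarrow> j \<noteq> M \<Longrightarrow> e j = 0" and M: "M \<ge> 1"
  shows "newton_psum e (Suc m * M) = of_nat M * ((-1) ^ (M + 1) * e M) ^ Suc m"
proof (induction m)
  case 0
  have "(\<Sum>j\<in>{1..<M}. (-1) ^ (j + 1) * e j * newton_psum e (M - j)) = 0"
    by (rule sum.neutral) (use e in auto)
  thus ?case using newton_psum.simps[of e M] by simp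
next
  case (Suc m)
  define N where "N = Suc (Suc m) * M"
  have N: "N > M" "N - M = Suc m * M" using M by (auto simp: N_def)
  have "(\<Sum>j\<in>{1..<N}. (-1) ^ (j + 1) * e j * newton_psum e (N - j)) = (\<Sum>j\<in>{M}. (-1) ^ (j + 1) * e j * newton_psum e (N - j))"
    by (rule sum.mono_neutral_right) (use e M N in auto)
  moreover have "e N = 0" using e[of N] N M by auto
  ultimately have "newton_psum e N = (-1) ^ (M + 1) * e M * newton_psum e (N - M)"
    by (subst newton_psum.simps) simp
  thus ?case unfolding N(2) Suc.IH by (simp add: N_def algebra_simps)
qed

section \<open>The quartic competitor in three variables\<close>

lemma cmod_le_of_circle:
  assumes "f holomorphic_on UNIV" "\<And>z. cmod z = 1 \<Longrightarrow> cmod (f z) \<le> B" "cmod z \<le> 1"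
  shows "cmod (f z) \<le> B"
proof (rule maximum_modulus_frontier[of f "cball 0 1"])
  show "f holomorphic_on interior (cball 0 1)" using assms(1) holomorphic_on_subset by blast
  show "continuous_on (closure (cball 0 1)) f"
    using assms(1) holomorphic_on_imp_continuous_on continuous_on_subset by blast
  show "cmod (f z) \<le> B" if "z \<in> frontier (cball 0 1)" for z
    using assms(2) that by (simp add: frontier_cball)
qed (use assms(3) in auto)

text \<open>The bare power sum \<open>3 p\<^sub>4\<close> has norm \<open>9\<close>, which is too large when \<open>n = 3\<close>. Subtracting
  \<open>p\<^sub>1 p\<^sub>3\<close> keeps the coefficient of \<open>s\<^sub>2\<^sup>2\<close> and gains \<open>9 \<bar>s\<^sub>1\<bar>\<^sup>2\<close> in the Cauchy-Schwarz estimate.\<close>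

definition quartic3 :: "complex \<Rightarrow> complex \<Rightarrow> complex \<Rightarrow> complex" where
  "quartic3 a b c = 3 * (a ^ 4 + b ^ 4 + c ^ 4) - (a + b + c) * (a ^ 3 + b ^ 3 + c ^ 3)"

text \<open>Two regimes for \<open>s = a + b + c\<close>. If \<open>|s| \<ge> 1\<close>, the
  Cauchy-Schwarz inequality for the three terms of the form \<open>a ^ 3 * (3 * a - s)\<close> gives
  at most \<open>sqrt 72 < 8.49\<close>. If \<open>|s| < 1\<close>, unimodularity leads to a bound
  by a polynomial in \<open>|s|\<close> alone, which is at most 8.\<close>

lemma quartic3_torus:
  assumes u: "cmod a = 1" "cmod b = 1" "cmod c = 1"
  shows "cmod (quartic3 a b c) \<le> 8.49"
proof -
  define s where "s = a + b + c"
  show ?thesis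
  proof (cases "cmod s \<ge> 1")
    case True
    define P where "P x = cmod (3 * x - s)" for x
    have "quartic3 a b c = a ^ 3 * (3 * a - s) + b ^ 3 * (3 * b - s) + c ^ 3 * (3 * c - s)"
      unfolding quartic3_def s_def by algebra
    also have "cmod \<dots> \<le> cmod (a ^ 3 * (3 * a - s)) + cmod (b ^ 3 * (3 * b - s)) + cmod (c ^ 3 * (3 * c - s))"
      by (intro norm_triangle_mono norm_triangle_ineq order_refl)
    also have "\<dots> = P a + P b + P c" by (simp add: P_def norm_mult norm_power u)
    finally have 1: "cmod (quartic3 a b c) \<le> P a + P b + P c" .
    have P2: "(P x)\<^sup>2 = 9 - 6 * (Re x * Re s + Im x * Im s) + (cmod s)\<^sup>2" if "cmod x = 1" for x
    proof -
      have "(Re x)\<^sup>2 + (Im x)\<^sup>2 = 1" using that by (simp flip: cmod_power2)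
      moreover have "(P x)\<^sup>2 = 9 * ((Re x)\<^sup>2 + (Im x)\<^sup>2) - 6 * (Re x * Re s + Im x * Im s) + ((Re s)\<^sup>2 + (Im s)\<^sup>2)"
        unfolding P_def cmod_power2 by (simp add: power2_eq_square algebra_simps)
      ultimately show ?thesis by (simp add: cmod_power2)
    qed
    have "(P a + P b + P c)\<^sup>2 \<le> 3 * ((P a)\<^sup>2 + (P b)\<^sup>2 + (P c)\<^sup>2)"
    proof -
      have "0 \<le> (P a - P b)\<^sup>2 + (P b - P c)\<^sup>2 + (P a - P c)\<^sup>2" by simp
      thus ?thesis by (simp add: power2_eq_square algebra_simps)
    qed
    also have "(P a)\<^sup>2 + (P b)\<^sup>2 + (P c)\<^sup>2 = 27 - 3 * (cmod s)\<^sup>2"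
    proof -
      have "(Re a * Re s + Im a * Im s) + (Re b * Re s + Im b * Im s) + (Re c * Re s + Im c * Im s)
        = (Re a + Re b + Re c) * Re s + (Im a + Im b + Im c) * Im s"
        by (simp add: algebra_simps)
      also have "\<dots> = (cmod s)\<^sup>2" unfolding cmod_power2 by (simp add: s_def power2_eq_square)
      finally have sum: "(Re a * Re s + Im a * Im s) + (Re b * Re s + Im b * Im s) + (Re c * Re s + Im c * Im s) = (cmod s)\<^sup>2" .
      have "9 - 6 * x + S + (9 - 6 * y + S) + (9 - 6 * z + S) = 27 - 3 * S" if "x + y + z = S" for x y z S :: real
        using that by simp
      from this[OF sum] show ?thesis unfolding P2[OF u(1)] P2[OF u(2)] P2[OF u(3)] .
    qed
    also have "3 * (27 - 3 * (cmod s)\<^sup>2) \<le> 72" using power_mono[OF True, of 2] by simp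
    also have "\<dots> \<le> (8.49 :: real)\<^sup>2" by (simp add: power2_eq_square)
    finally have "P a + P b + P c \<le> 8.49" by (rule power2_le_imp_le) simp
    thus ?thesis using 1 by simp
  next
    case False
    define e2 e3 \<rho> where "e2 = a * b + b * c + c * a" and "e3 = a * b * c" and "\<rho> = cmod s"
    have \<rho>: "\<rho> \<ge> 0" "\<rho> \<le> 1" using False by (auto simp: \<rho>_def)
    have cn: "x * cnj x = 1" if "cmod x = 1" for x
      using that by (simp flip: complex_norm_square)
    \<comment> \<open>On the torus the inverse of each variable is its conjugate.\<close>
    have e2: "e2 = cnj s * e3"
    proof -
      have "cnj s * e3 = (a * cnj a) * b * c + (b * cnj b) * a * c + (c * cnj c) * a * b"
        unfolding s_def e3_def complex_cnj_add by algebra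
      thus ?thesis by (simp add: cn u e2_def algebra_simps)
    qed
    have ss: "s * cnj s = of_real (\<rho>\<^sup>2)" unfolding \<rho>_def complex_norm_square ..
    have e3: "cmod e3 = 1" by (simp add: e3_def norm_mult u)
    have e2': "cmod e2 = \<rho>" by (simp add: e2 norm_mult e3 \<rho>_def)
    have "quartic3 a b c = 2 * s ^ 4 - 9 * s\<^sup>2 * e2 + 6 * e2\<^sup>2 + 9 * s * e3"
      unfolding quartic3_def s_def e2_def e3_def by algebra
    also have "\<dots> = 2 * s ^ 4 + 9 * s * e3 * (1 - s * cnj s) + 6 * e2\<^sup>2"
      unfolding e2 by algebra
    also have "1 - s * cnj s = of_real (1 - \<rho>\<^sup>2)"
      unfolding ss by simp
    also have "cmod (2 * s ^ 4 + 9 * s * e3 * of_real (1 - \<rho>\<^sup>2) + 6 * e2\<^sup>2)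
        \<le> cmod (2 * s ^ 4) + cmod (9 * s * e3 * of_real (1 - \<rho>\<^sup>2)) + cmod (6 * e2\<^sup>2)"
      by (intro norm_triangle_mono norm_triangle_ineq order_refl)
    also have "\<dots> = 2 * \<rho> ^ 4 + 9 * \<rho> * (1 - \<rho>\<^sup>2) + 6 * \<rho>\<^sup>2"
    proof -
      have "1 - \<rho>\<^sup>2 \<ge> 0" using \<rho> by (simp add: power_le_one)
      hence "cmod (of_real (1 - \<rho>\<^sup>2)) = 1 - \<rho>\<^sup>2" unfolding norm_of_real by (rule abs_of_nonneg)
      thus ?thesis unfolding norm_mult norm_power e3 e2' \<rho>_def[symmetric] by simp
    qed
    also have "\<dots> \<le> 2 * \<rho> ^ 3 + 9 * \<rho> * (1 - \<rho>\<^sup>2) + 6 * \<rho>\<^sup>2"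
      using power_decreasing[of 3 4 \<rho>] \<rho> by simp
    also have "\<dots> \<le> 8"
    proof -
      have "\<rho>\<^sup>2 \<le> 1" using \<rho> by (simp add: power_le_one)
      \<comment> \<open>The product is 8 minus the cubic to be bounded, and both factors are
        nonnegative on the unit interval.\<close>
      hence "0 \<le> (1 - \<rho>) * (8 - \<rho> - 7 * \<rho>\<^sup>2)" using \<rho> by (intro mult_nonneg_nonneg) auto
      thus ?thesis by (simp add: algebra_simps power2_eq_square power3_eq_cube)
    qed
    finally show ?thesis by simp
  qed
qed

text \<open>The maximum principle moves the variables to the unit circle one after another.\<close>

lemma quartic3_polydisc:
  assumes "cmod a \<le> 1" "cmod b \<le> 1" "cmod c \<le> 1"
  shows "cmod (quartic3 a b c) \<le> 8.49"
proof (rule cmod_le_of_circle[where f = "\<lambda>a. quartic3 a b c"])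
  fix a assume a: "cmod a = 1"
  show "cmod (quartic3 a b c) \<le> 8.49"
  proof (rule cmod_le_of_circle[where f = "\<lambda>b. quartic3 a b c"])
    fix b assume b: "cmod b = 1"
    show "cmod (quartic3 a b c) \<le> 8.49"
    proof (rule cmod_le_of_circle[where f = "\<lambda>c. quartic3 a b c"])
      show "cmod (quartic3 a b c) \<le> 8.49" if "cmod c = 1" for c
        by (rule quartic3_torus[OF a b that])
    qed (auto simp: quartic3_def assms intro!: holomorphic_intros)
  qed (auto simp: quartic3_def assms intro!: holomorphic_intros)
qed (auto simp: quartic3_def assms intro!: holomorphic_intros)

section \<open>Comparison of the two metrics\<close>

context coordinate_labelling
begin

text \<open>Indexed by weight instead of by elements of the type. The values 1 at 0 and 0 above
  \<open>CARD('n)\<close> are those of the elementary symmetric functions in \<open>CARD('n)\<close>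
  variables, as Newton's recursion requires.\<close>

definition coordinate :: "complex^'n \<Rightarrow> nat \<Rightarrow> complex" where
  "coordinate x j = (if j = 0 then 1 else if j \<le> CARD('n) then x $ inv \<sigma> j else 0)"

lemma \<sigma>_inv: "1 \<le> j \<Longrightarrow> j \<le> CARD('n) \<Longrightarrow> \<sigma> (inv \<sigma> j) = j"
  using \<sigma>_surj by (metis f_inv_into_f rangeI)

lemma coordinate_esym:
  fixes l :: "complex^'n"
  assumes "\<And>k. x $ k = esym (\<sigma> k) l"
  shows "coordinate x j = (if j \<le> CARD('n) then esym j l else 0)"
  using assms \<sigma>_inv[of j] by (auto simp: coordinate_def)

lemma cmod_coordinate_le: "1 \<le> j \<Longrightarrow> cmod (coordinate x j) \<le> norm x"
  using Finite_Cartesian_Product.norm_nth_le[of x] by (simp add: coordinate_def)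

lemma coordinate_line: "\<exists>q. \<forall>z. coordinate (a + z *s b) j = poly q z"
proof -
  define q where "q = (if j = 0 then 1 else if j \<le> CARD('n) then [:a $ inv \<sigma> j, b $ inv \<sigma> j:] else 0)"
  have "coordinate (a + z *s b) j = poly q z" for z by (simp add: coordinate_def q_def)
  thus ?thesis by blast
qed

lemma continuous_on_coordinate: "continuous_on S (\<lambda>x. coordinate x j)"
  unfolding coordinate_def by (cases "j = 0"; cases "j \<le> CARD('n)") (auto intro!: continuous_intros)

lemma coordinate_axis: "1 \<le> j \<Longrightarrow> coordinate (t *s axis k 1) j = (if j = \<sigma> k then t else 0)"
  using \<sigma>_inv[of j] \<sigma>_range[of k] \<sigma>_inj by (auto simp: coordinate_def axis_def)

definition psum :: "nat \<Rightarrow> complex^'n \<Rightarrow> complex" where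
  "psum N x = newton_psum (coordinate x) N"

lemma psum_line: "\<exists>q. \<forall>z. psum N (a + z *s b) = poly q z"
  unfolding psum_def by (rule newton_psum_line[OF coordinate_line])

lemma continuous_on_psum: "continuous_on S (psum N)"
  unfolding psum_def by (rule newton_psum_continuous[OF continuous_on_coordinate])

lemma psum_order:
  assumes "m * CARD('n) < N"
  obtains K where "K \<ge> 0" "\<And>x. norm x \<le> 1 \<Longrightarrow> cmod (psum N x) \<le> K * norm x ^ Suc m"
proof -
  obtain K where K: "\<And>x. norm x \<le> 1 \<Longrightarrow> cmod (psum N x) \<le> K * norm x ^ Suc m"
    using newton_psum_order[of coordinate "CARD('n)" m N] assms cmod_coordinate_le
    unfolding psum_def by (force simp: coordinate_def)
  show ?thesis
  proof (rule that[of "max K 0"])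
    fix x :: "complex^'n" assume "norm x \<le> 1"
    from K[OF this] show "cmod (psum N x) \<le> max K 0 * norm x ^ Suc m"
      by (rule order.trans) (intro mult_right_mono, auto)
  qed simp
qed

lemma psum_eq:
  fixes l :: "complex^'n"
  assumes "\<And>k. x $ k = esym (\<sigma> k) l" "N \<ge> 1"
  shows "psum N x = (\<Sum>i\<in>UNIV. (l $ i) ^ N)"
  unfolding psum_def by (rule newton_psum_esym[OF coordinate_esym[OF assms(1)] assms(2)])

lemma psum_axis:
  assumes "\<sigma> k = M"
  shows "psum (Suc m * M) (t *s axis k 1) = of_nat M * ((-1) ^ (M + 1) * t) ^ Suc m"
  unfolding psum_def using assms \<sigma>_range(1)[of k]
  by (subst newton_psum_single) (auto simp: coordinate_axis)

section \<open>Estimates along the axis of weight \<open>n - 1\<close>\<close>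

lemma symm_polydiskE:
  assumes "x \<in> symm_polydisk \<sigma>"
  obtains l :: "complex^'n" where "\<And>i. cmod (l $ i) < 1" "\<And>k. x $ k = esym (\<sigma> k) l"
  using assms unfolding symm_polydisk_def by auto

text \<open>The roots are 0 and the \<open>M\<close>-th roots of a number of modulus
  \<open>|t|\<close>.\<close>

lemma axis_in_symm_polydisk:
  assumes n: "CARD('n) = Suc M" "M \<ge> 2" and k0: "\<sigma> k0 = M" and t: "cmod t < 1"
  shows "t *s axis k0 1 \<in> symm_polydisk \<sigma>"
proof (rule symm_polydiskI_roots[of "coordinate (t *s axis k0 1)"])
  let ?e = "coordinate (t *s axis k0 1)"
  fix z assume 0: "(\<Sum>j\<le>CARD('n). (-1) ^ j * ?e j * z ^ (CARD('n) - j)) = 0"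
  have e: "?e 0 = 1" "?e M = t" "?e 1 = 0" "?e (Suc M) = 0" "\<And>j. 1 < j \<Longrightarrow> j < M \<Longrightarrow> ?e j = 0"
    using n k0 coordinate_axis by (auto simp: coordinate_def[of _ 0])
  have "z ^ Suc M + (-1) ^ M * t * z = 0"
    using trans[OF sum_weighted_support[of M ?e z, OF n(2) e(1) e(5), symmetric] 0[unfolded n(1)]]
    unfolding e by simp
  hence "z * (z ^ M + (-1) ^ M * t) = 0" by (simp add: algebra_simps)
  hence "z = 0 \<or> z ^ M = - ((-1) ^ M * t)" by (auto simp: add_eq_0_iff2)
  hence "z = 0 \<or> cmod z ^ M = cmod t"
    by (metis mult_1 norm_minus_cancel norm_mult norm_one norm_power power_one)
  thus "cmod z < 1"
  proof
    assume "cmod z ^ M = cmod t"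
    hence "cmod z ^ M < 1" using t by simp
    thus ?thesis by (metis not_less one_le_power)
  qed simp
next
  show "(t *s axis k0 1) $ k = coordinate (t *s axis k0 1) (\<sigma> k)" for k
    using coordinate_axis[OF \<sigma>_range(1)] \<sigma>_inj by (simp add: axis_def)
qed (simp add: coordinate_def)

text \<open>It suffices to find \<open>F\<close> of modulus below 1 on the domain that vanishes to
  order \<open>m\<close> at the origin and has modulus \<open>c * |t| ^ m\<close> on the axis, with
  \<open>c\<close> larger than \<open>reiffen_bound M ^ m\<close>; then \<open>\<beta>\<close> is
  the \<open>m\<close>-th root of \<open>c\<close>.\<close>

lemma green_fun_axis_lower_bound:
  assumes n: "CARD('n) = Suc M" "M \<ge> 2" and k0: "\<sigma> k0 = M"
  shows "\<exists>\<beta> > reiffen_bound M. \<forall>t. 0 < cmod t \<longrightarrow> cmod t < 1 \<longrightarrow>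
    \<beta> * cmod t \<le> eexp (green_fun (symm_polydisk \<sigma>) 0 (t *s axis k0 1))"
proof -
  have gen: ?thesis
    if c: "c > 0" "reiffen_bound M ^ m < c" and m: "m \<ge> 1"
      and lines: "\<And>a b. \<exists>q. \<forall>z. F (a + z *s b) = poly q z" and cont: "continuous_on UNIV F"
      and lt1: "\<And>x. x \<in> symm_polydisk \<sigma> \<Longrightarrow> cmod (F x) < 1"
      and ord: "\<And>x. norm x \<le> 1 \<Longrightarrow> cmod (F x) \<le> K * norm x ^ m"
      and val: "\<And>t. cmod (F (t *s axis k0 1)) = c * cmod t ^ m"
    for F :: "complex^'n \<Rightarrow> complex" and c m K
  proof (intro exI[of _ "exp (ln c / real m)"] conjI allI impI)
    show "exp (ln c / real m) > reiffen_bound M" using less_exp_ln_div[OF c(1) _ c(2)] m by simp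
    fix t :: complex assume t: "0 < cmod t" "cmod t < 1"
    have "\<forall>\<^sub>F x in at 0. cmod (F x) \<le> K * norm x ^ m"
      unfolding eventually_at by (intro exI[of _ 1]) (auto intro: ord less_imp_le)
    moreover have "F (t *s axis k0 1) \<noteq> 0"
    proof -
      have "cmod (F (t *s axis k0 1)) > 0" unfolding val using c(1) t by simp
      thus ?thesis by auto
    qed
    ultimately have "exp (ln (cmod (F (t *s axis k0 1))) / m) \<le> eexp (green_fun (symm_polydisk \<sigma>) 0 (t *s axis k0 1))"
      using axis_in_symm_polydisk[OF n k0 t(2)]
      by (intro green_fun_lower_bound[OF lines cont lt1 m])
    moreover have "exp (ln (cmod (F (t *s axis k0 1))) / m) = exp (ln c / real m) * cmod t"
      unfolding val using c(1) m t by (intro exp_ln_div_power) auto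
    ultimately show "exp (ln c / real m) * cmod t \<le> eexp (green_fun (symm_polydisk \<sigma>) 0 (t *s axis k0 1))"
      by simp
  qed
  show ?thesis
  proof (cases "M = 2")
    case False
    hence M: "M \<ge> 3" using n by simp
    \<comment> \<open>On the axis this power sum has modulus \<open>M * |t| ^ M\<close>. Since
      \<open>M * M\<close> exceeds \<open>(M - 1) * (M + 1)\<close> by 1, it vanishes to order
      \<open>M\<close> at the origin.\<close>
    define F where "F x = psum (M * M) x / of_nat (Suc M)" for x
    have "(M - 1) * CARD('n) < M * M" using M by (cases M) (auto simp: n)
    then obtain K where K: "K \<ge> 0" "\<And>x. norm x \<le> 1 \<Longrightarrow> cmod (psum (M * M) x) \<le> K * norm x ^ Suc (M - 1)"
      using psum_order by blast
    have F_le: "cmod (F x) \<le> cmod (psum (M * M) x)" for x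
    proof -
      have "cmod (psum (M * M) x) / real (Suc M) \<le> cmod (psum (M * M) x) / 1"
        by (intro divide_left_mono) auto
      thus ?thesis by (simp add: F_def norm_divide del: of_nat_Suc)
    qed
    show ?thesis
    proof (rule gen[of "real M / real (Suc M)" M F K])
      show "real M / real (Suc M) > 0" "M \<ge> 1" using M by auto
      show "reiffen_bound M ^ M < real M / real (Suc M)" by (rule reiffen_bound_power[OF M])
      show "\<exists>q. \<forall>z. F (a + z *s b) = poly q z" for a b
      proof -
        obtain q where q: "\<And>z. psum (M * M) (a + z *s b) = poly q z" using psum_line by metis
        have "F (a + z *s b) = poly (smult (1 / of_nat (Suc M)) q) z" for z
          by (simp add: F_def q)
        thus ?thesis by blast
      qed
      show "continuous_on UNIV F" unfolding F_def
        by (intro continuous_intros continuous_on_psum) (simp del: of_nat_Suc)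
      show "cmod (F x) < 1" if x: "x \<in> symm_polydisk \<sigma>" for x
      proof -
        obtain l :: "complex^'n" where l: "\<And>i. cmod (l $ i) < 1" "\<And>k. x $ k = esym (\<sigma> k) l"
          using symm_polydiskE[OF x] by blast
        have "cmod (psum (M * M) x) \<le> (\<Sum>i\<in>UNIV. cmod (l $ i) ^ (M * M))"
          using M by (subst psum_eq[OF l(2)]) (auto simp: norm_power intro!: sum_norm_le)
        also have "\<dots> < (\<Sum>i\<in>(UNIV :: 'n set). 1)"
          using M l(1) by (intro sum_strict_mono) (auto intro!: power_Suc_less_one simp: power_less_one_iff)
        also have "\<dots> = real (Suc M)" by (simp add: n)
        finally show ?thesis by (simp add: F_def norm_divide del: of_nat_Suc)
      qed
      show "cmod (F x) \<le> K * norm x ^ M" if "norm x \<le> 1" for x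
        using F_le[of x] K(2)[OF that] M by simp
      show "cmod (F (t *s axis k0 1)) = real M / real (Suc M) * cmod t ^ M" for t
        using psum_axis[OF k0, of "M - 1" t] M
        by (simp add: F_def norm_divide norm_mult norm_power del: of_nat_Suc)
    qed
  next
    case True
    note M = this
    \<comment> \<open>The divisor \<open>8.52\<close> exceeds the bound \<open>8.49\<close>, so the
      modulus stays strictly below 1; it equals \<open>6 * 1.42\<close>, so the numerator
      \<open>6 * t\<^sup>2\<close> on the axis yields \<open>c = 1 / 1.42\<close>. Both
      \<open>psum 4\<close> and the product of \<open>psum 1\<close> and \<open>psum 3\<close>
      vanish to second order.\<close>
    define F where "F x = (3 * psum 4 x - psum 1 x * psum 3 x) / 8.52" for x
    obtain K4 where K4: "K4 \<ge> 0" "\<And>x. norm x \<le> 1 \<Longrightarrow> cmod (psum 4 x) \<le> K4 * norm x ^ Suc 1"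
      using psum_order[of 1 4] n M by auto
    obtain K1 where K1: "K1 \<ge> 0" "\<And>x. norm x \<le> 1 \<Longrightarrow> cmod (psum 1 x) \<le> K1 * norm x ^ Suc 0"
      using psum_order[of 0 1] by auto
    obtain K3 where K3: "K3 \<ge> 0" "\<And>x. norm x \<le> 1 \<Longrightarrow> cmod (psum 3 x) \<le> K3 * norm x ^ Suc 0"
      using psum_order[of 0 3] by auto
    show ?thesis
    proof (rule gen[of "1 / 1.42" 2 F "3 * K4 + K1 * K3"])
      show "reiffen_bound M ^ 2 < 1 / 1.42" using reiffen_bound_2 M by simp
      show "\<exists>q. \<forall>z. F (a + z *s b) = poly q z" for a b
      proof -
        obtain q1 where q1: "\<And>z. psum 1 (a + z *s b) = poly q1 z" using psum_line by metis
        obtain q3 where q3: "\<And>z. psum 3 (a + z *s b) = poly q3 z" using psum_line by metis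
        obtain q4 where q4: "\<And>z. psum 4 (a + z *s b) = poly q4 z" using psum_line by metis
        have "F (a + z *s b) = poly (smult (1 / 8.52) (smult 3 q4 - q1 * q3)) z" for z
          by (simp add: F_def q1[simplified] q3 q4)
        thus ?thesis by blast
      qed
      show "continuous_on UNIV F" unfolding F_def by (intro continuous_intros continuous_on_psum) auto
      show "cmod (F x) < 1" if x: "x \<in> symm_polydisk \<sigma>" for x
      proof -
        obtain l :: "complex^'n" where l: "\<And>i. cmod (l $ i) < 1" "\<And>k. x $ k = esym (\<sigma> k) l"
          using symm_polydiskE[OF x] by blast
        obtain a b c where abc: "(UNIV :: 'n set) = {a, b, c}" "a \<noteq> b" "b \<noteq> c" "a \<noteq> c"
          using n M card_3_iff[of "UNIV :: 'n set"] by auto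
        have ps: "psum N x = (l $ a) ^ N + (l $ b) ^ N + (l $ c) ^ N" if "N \<ge> 1" for N
          using abc(2-4) unfolding psum_eq[OF l(2) that] abc(1) by simp
        have Fx: "F x = quartic3 (l $ a) (l $ b) (l $ c) / 8.52"
          by (simp add: F_def ps quartic3_def)
        have "cmod (quartic3 (l $ a) (l $ b) (l $ c)) \<le> 8.49"
          using l(1) by (intro quartic3_polydisc) (auto intro: less_imp_le)
        thus ?thesis unfolding Fx norm_divide by simp
      qed
      show "cmod (F x) \<le> (3 * K4 + K1 * K3) * norm x ^ 2" if x: "norm x \<le> 1" for x
      proof -
        have "cmod (3 * psum 4 x - psum 1 x * psum 3 x) \<le> cmod (3 * psum 4 x) + cmod (psum 1 x * psum 3 x)"
          by (rule norm_triangle_ineq4)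
        also have "\<dots> \<le> 3 * (K4 * norm x ^ Suc 1) + (K1 * norm x ^ Suc 0) * (K3 * norm x ^ Suc 0)"
          unfolding norm_mult using K4(2)[OF x] K1 K3(2)[OF x] K1(2)[OF x]
          by (intro add_mono mult_mono) auto
        also have "\<dots> = (3 * K4 + K1 * K3) * norm x ^ 2" by (simp add: power2_eq_square algebra_simps)
        finally have "cmod (3 * psum 4 x - psum 1 x * psum 3 x) \<le> (3 * K4 + K1 * K3) * norm x ^ 2" .
        moreover have "cmod (w / 8.52) \<le> cmod w" for w unfolding norm_divide by simp
        hence "cmod (F x) \<le> cmod (3 * psum 4 x - psum 1 x * psum 3 x)"
          unfolding F_def .
        ultimately show ?thesis by linarith
      qed
      show "cmod (F (t *s axis k0 1)) = 1 / 1.42 * cmod t ^ 2" for t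
      proof -
        have "psum 4 (t *s axis k0 1) = 2 * t\<^sup>2"
          using psum_axis[of k0 2 1 t] k0 M by (simp add: power2_eq_square)
        moreover have "psum 1 (t *s axis k0 1) = 0"
          using k0 M by (simp add: psum_def newton_psum.simps[of _ "Suc 0"] coordinate_axis)
        ultimately show ?thesis by (simp add: F_def norm_divide norm_mult norm_power)
      qed
    qed auto
  qed
qed

text \<open>Schwarz's lemma is used twice: first to write \<open>h z = z * g z\<close> with
  \<open>|g| \<le> 1\<close> and \<open>|g 0|\<close> at most \<open>reiffen_bound M\<close>, then
  to estimate \<open>g - g 0\<close>. The error term is the same for all \<open>f\<close>, so the
  estimate passes to the supremum.\<close>

lemma caratheodory_disc_bound:
  assumes n: "CARD('n) = Suc M" "M \<ge> 2" and k0: "\<sigma> k0 = M" and t: "cmod t < 1"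
    and f: "f \<in> holo_to_disc (symm_polydisk \<sigma>)" "f 0 = 0"
  shows "cmod (f (t *s axis k0 1)) \<le> reiffen_bound M * cmod t + 3 * (cmod t)\<^sup>2"
proof -
  let ?D = "symm_polydisk \<sigma>"
  have fh: "holo_on ?D f" and f1: "\<And>x. x \<in> ?D \<Longrightarrow> cmod (f x) < 1"
    using f by (auto simp: holo_to_disc_def image_subset_iff)
  obtain L where L: "(f has_derivative L) (at 0)" "\<And>c v. L (c *s v) = c * L v"
    using fh zero_in_symm_polydisk unfolding holo_on_def by blast
  define h where "h z = f (z *s axis k0 1)" for z
  have dv: "((\<lambda>z. z *s axis k0 1) has_derivative (\<lambda>h. h *s axis k0 1)) (at z)" for z :: complex
    using has_derivative_scale_left[OF DERIV_ident, of "axis k0 1"] by simp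
  have inD: "z *s axis k0 1 \<in> ?D" if "cmod z < 1" for z
    by (rule axis_in_symm_polydisk[OF n k0 that])
  have hol: "h holomorphic_on ball 0 1"
    unfolding h_def by (rule holomorphic_on_comp_vec[OF fh]) (use inD in simp, rule exI, rule dv)
  have h0: "h 0 = 0" using f by (simp add: h_def)
  have h1: "cmod (h z) < 1" if "cmod z < 1" for z
    unfolding h_def by (rule f1[OF inD[OF that]])
  have "(h has_field_derivative L (axis k0 1)) (at 0)"
    unfolding h_def by (rule has_field_derivative_comp_vec[OF dv _ L(2)]) (use L(1) in simp)
  hence dh: "deriv h 0 = L (axis k0 1)" by (rule DERIV_imp_deriv)
  obtain g where g: "g holomorphic_on ball 0 1" "\<And>z. cmod z < 1 \<Longrightarrow> h z = z * g z" "deriv h 0 = g 0"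
    using Schwarz3[OF hol h0] by blast
  have g0: "cmod (g 0) \<le> reiffen_bound M"
    using derivative_bound[OF n k0 f(1) L(1)] by (simp add: g(3)[symmetric] dh)
  have g1: "cmod (g z) \<le> 1" if z: "cmod z < 1" for z
  proof (cases "z = 0")
    case True
    thus ?thesis using Schwarz_Lemma(2)[OF hol h0 h1, of 0] g(3) by simp
  next
    case False
    have "cmod z * cmod (g z) \<le> cmod z * 1"
      using Schwarz_Lemma(1)[OF hol h0 h1 z] g(2)[OF z] by (simp add: norm_mult)
    thus ?thesis by (rule mult_left_le_imp_le) (use False in simp)
  qed
  \<comment> \<open>As \<open>|g z - g 0| \<le> 2\<close>, division by 3 gives a map into the open
    disc.\<close>
  have "cmod ((g t - g 0) / 3) \<le> cmod t"
  proof (rule Schwarz_Lemma(1)[where f = "\<lambda>z. (g z - g 0) / 3"])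
    show "(\<lambda>z. (g z - g 0) / 3) holomorphic_on ball 0 1" by (intro holomorphic_intros g) auto
    show "cmod ((g z - g 0) / 3) < 1" if "cmod z < 1" for z
      using norm_triangle_ineq4[of "g z" "g 0"] g1[OF that] g1[of 0] by (simp add: norm_divide)
  qed (use t in auto)
  hence "cmod (g t - g 0) \<le> 3 * cmod t" by (simp add: norm_divide)
  hence "cmod (g t) \<le> reiffen_bound M + 3 * cmod t"
    using g0 norm_triangle_ineq2[of "g t" "g 0"] by linarith
  hence "cmod t * cmod (g t) \<le> cmod t * (reiffen_bound M + 3 * cmod t)"
    by (intro mult_left_mono) auto
  also have "cmod t * cmod (g t) = cmod (f (t *s axis k0 1))"
    using g(2)[OF t] by (simp add: h_def norm_mult)
  finally show ?thesis by (simp add: power2_eq_square algebra_simps)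
qed

end

lemma zero_in_holo_to_disc: "(\<lambda>_. 0) \<in> holo_to_disc D"
  unfolding holo_to_disc_def holo_on_def by (auto intro!: exI[of _ "\<lambda>_. 0"])

theorem theorem1p3:
  fixes \<sigma> :: "'n::finite \<Rightarrow> nat" and k0 :: 'n
  assumes "CARD('n) \<ge> 3"
    and "bij_betw \<sigma> UNIV {1..CARD('n)}"
    and "\<sigma> k0 = CARD('n) - 1"
  shows "ereal (caratheodory_reiffen (symm_polydisk \<sigma>) 0 (axis k0 1))
           < azukawa (symm_polydisk \<sigma>) 0 (axis k0 1)
       \<and> (\<exists>\<epsilon>>0. \<forall>t::complex. 0 < cmod t \<and> cmod t < \<epsilon> \<longrightarrow>
            caratheodory_pd (symm_polydisk \<sigma>) 0 (t *s axis k0 1)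
              < eexp (green_fun (symm_polydisk \<sigma>) 0 (t *s axis k0 1)))"
proof -
  interpret coordinate_labelling \<sigma> by standard (rule assms(2))
  let ?D = "symm_polydisk \<sigma>"
  define M where "M = CARD('n) - 1"
  have n: "CARD('n) = Suc M" "M \<ge> 2" and k0: "\<sigma> k0 = M"
    using assms(1,3) by (auto simp: M_def)
  obtain \<beta> where \<beta>: "reiffen_bound M < \<beta>"
    "\<And>t. 0 < cmod t \<Longrightarrow> cmod t < 1 \<Longrightarrow> \<beta> * cmod t \<le> eexp (green_fun ?D 0 (t *s axis k0 1))"
    using green_fun_axis_lower_bound[OF n k0] by blast
  have "caratheodory_reiffen ?D 0 (axis k0 1) \<le> reiffen_bound M"
    unfolding caratheodory_reiffen_def
  proof (rule cSup_least)
    have "((\<lambda>_. 0) has_derivative (\<lambda>_. 0)) (at (0 :: complex^'n))" by simp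
    thus "{cmod (L (axis k0 1)) |f L. f \<in> holo_to_disc ?D \<and> f 0 = 0 \<and> (f has_derivative L) (at 0)} \<noteq> {}"
      using zero_in_holo_to_disc[of ?D] by blast
  qed (use derivative_bound[OF n k0] in auto)
  hence "ereal (caratheodory_reiffen ?D 0 (axis k0 1)) < ereal \<beta>" using \<beta>(1) by simp
  also have "\<dots> \<le> azukawa ?D 0 (axis k0 1)"
    unfolding azukawa_def
  proof (rule le_Limsup)
    show "\<forall>\<^sub>F s in at 0. ereal \<beta> \<le> ereal (eexp (green_fun ?D 0 (0 + s *s axis k0 1)) / cmod s)"
      unfolding eventually_at
    proof (intro exI[of _ 1] conjI ballI impI)
      fix s :: complex assume "s \<noteq> 0 \<and> dist s 0 < 1"
      thus "ereal \<beta> \<le> ereal (eexp (green_fun ?D 0 (0 + s *s axis k0 1)) / cmod s)"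
        using \<beta>(2)[of s] by (simp add: pos_le_divide_eq)
    qed simp
  qed simp
  finally have 1: "ereal (caratheodory_reiffen ?D 0 (axis k0 1)) < azukawa ?D 0 (axis k0 1)" .
  \<comment> \<open>The second entry ensures \<open>reiffen_bound M + 3 * |t| < \<beta>\<close>; the
    first keeps \<open>t\<close> in the unit disc, where both estimates hold.\<close>
  define \<epsilon> where "\<epsilon> = min 1 ((\<beta> - reiffen_bound M) / 3)"
  have "\<epsilon> > 0" using \<beta>(1) by (simp add: \<epsilon>_def)
  moreover have "caratheodory_pd ?D 0 (t *s axis k0 1) < eexp (green_fun ?D 0 (t *s axis k0 1))"
    if t: "0 < cmod t" "cmod t < \<epsilon>" for t
  proof -
    have t1: "cmod t < 1" "3 * cmod t < \<beta> - reiffen_bound M" using t by (auto simp: \<epsilon>_def)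
    have "caratheodory_pd ?D 0 (t *s axis k0 1) \<le> reiffen_bound M * cmod t + 3 * (cmod t)\<^sup>2"
      unfolding caratheodory_pd_def
    proof (rule cSup_least)
      show "{cmod (f (t *s axis k0 1)) |f. f \<in> holo_to_disc ?D \<and> f 0 = 0} \<noteq> {}"
        using zero_in_holo_to_disc[of ?D] by blast
    qed (use caratheodory_disc_bound[OF n k0 t1(1)] in auto)
    also have "\<dots> = (reiffen_bound M + 3 * cmod t) * cmod t"
      by (simp add: power2_eq_square algebra_simps)
    also have "\<dots> < \<beta> * cmod t" using t t1 by (intro mult_strict_right_mono) auto
    also have "\<dots> \<le> eexp (green_fun ?D 0 (t *s axis k0 1))" by (rule \<beta>(2)[OF t(1) t1(1)])
    finally show ?thesis .
  qed
  ultimately show ?thesis using 1 by blast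
qed

end
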